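(* For a graph $G$ the following conditions are equivalent: (i) $G$ is Helly; (ii) $G$ is $1$--Helly and weakly modular; (iii) $G$ is clique-Helly and dismantlable; (iv) $G$ is clique-Helly and its clique complex is simply connected. Moreover, if the clique complex $X(G)$ of $G$ is finite-dimensional, then (i)--(iv) are also equivalent to: (v) $G$ is clique-Helly and its clique complex is contractible.
   Context: Graphs are simple, undirected, connected, possibly infinite; $B_r(v)=\{x:d(v,x)\le r\}$. A family of sets has the Helly property if every subfamily of pairwise intersecting members has nonempty intersection. $G$ is Helly if the family of all balls has the Helly property; $1$--Helly if the family of balls of radius $1$ has it; clique-Helly if the family of maximal cliques has it. Weakly modular: for every vertex $u$, (TC) for $v,w$ with $1=d(v,w)<d(u,v)=d(u,w)$ there is a common neighbor $x$ of $v,w$ with $d(u,x)=d(u,v)-1$, and (QC) for $v,w,z$ with $d(v,z)=d(w,z)=1$, $2=d(v,w)\le d(u,v)=d(u,w)=d(u,z)-1$ there is a common neighbor $x$ of $v,w$ with $d(u,x)=d(u,v)-1$. A vertex $x$ is dominated by $y$ in a graph if $B_1(x)\subseteq B_1(y)$ there. $G$ is dismantlable if $V(G)$ admits a well-order $\prec$ such that each vertex $v$ other than the least one has a neighbor $w\prec v$ which dominates $v$ in the subgraph of $G$ induced by $\{u: u\preceq v\}$. The clique complex $X(G)$ is the simplicial complex whose simplices are the finite cliques of $G$. *)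

theory Defs
  imports "HOL-Analysis.Analysis"
begin

text \<open>Graphs: the vertex set is the whole type 'a; E is the adjacency relation
  (assumed symmetric and irreflexive in the theorem).\<close>

definition gdist :: "('a \<Rightarrow> 'a \<Rightarrow> bool) \<Rightarrow> 'a \<Rightarrow> 'a \<Rightarrow> nat" where
  "gdist E u v = (LEAST n. (u, v) \<in> {(x, y). E x y} ^^ n)"

definition gconnected :: "('a \<Rightarrow> 'a \<Rightarrow> bool) \<Rightarrow> bool" where
  "gconnected E \<longleftrightarrow> (\<forall>u v. (u, v) \<in> {(x, y). E x y}\<^sup>*)"

definition gball :: "('a \<Rightarrow> 'a \<Rightarrow> bool) \<Rightarrow> nat \<Rightarrow> 'a \<Rightarrow> 'a set" where
  "gball E r v = {x. gdist E v x \<le> r}"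

definition Helly_family :: "'b set set \<Rightarrow> bool" where
  "Helly_family F \<longleftrightarrow>
     (\<forall>S. S \<subseteq> F \<and> (\<forall>A\<in>S. \<forall>B\<in>S. A \<inter> B \<noteq> {}) \<longrightarrow> \<Inter>S \<noteq> {})"

definition Helly :: "('a \<Rightarrow> 'a \<Rightarrow> bool) \<Rightarrow> bool" where
  "Helly E \<longleftrightarrow> Helly_family {gball E r v | r v. True}"

definition one_Helly :: "('a \<Rightarrow> 'a \<Rightarrow> bool) \<Rightarrow> bool" where
  "one_Helly E \<longleftrightarrow> Helly_family {gball E 1 v | v. True}"

definition clique :: "('a \<Rightarrow> 'a \<Rightarrow> bool) \<Rightarrow> 'a set \<Rightarrow> bool" where
  "clique E C \<longleftrightarrow> (\<forall>x\<in>C. \<forall>y\<in>C. x \<noteq> y \<longrightarrow> E x y)"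

definition maximal_clique :: "('a \<Rightarrow> 'a \<Rightarrow> bool) \<Rightarrow> 'a set \<Rightarrow> bool" where
  "maximal_clique E C \<longleftrightarrow> clique E C \<and> (\<forall>D. clique E D \<and> C \<subseteq> D \<longrightarrow> D = C)"

definition clique_Helly :: "('a \<Rightarrow> 'a \<Rightarrow> bool) \<Rightarrow> bool" where
  "clique_Helly E \<longleftrightarrow> Helly_family {C. maximal_clique E C}"

definition weakly_modular :: "('a \<Rightarrow> 'a \<Rightarrow> bool) \<Rightarrow> bool" where
  "weakly_modular E \<longleftrightarrow>
    (\<forall>u v w. E v w \<and> 1 < gdist E u v \<and> gdist E u v = gdist E u w \<longrightarrow>
        (\<exists>x. E x v \<and> E x w \<and> gdist E u x = gdist E u v - 1)) \<and>
    (\<forall>u v w z. E v z \<and> E w z \<and> gdist E v w = 2 \<and> 2 \<le> gdist E u v \<and>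
        gdist E u v = gdist E u w \<and> gdist E u z = gdist E u v + 1 \<longrightarrow>
        (\<exists>x. E x v \<and> E x w \<and> gdist E u x = gdist E u v - 1))"

text \<open>Dismantlability: a well-order r on all vertices (pairs (a,b) in r mean a \<preceq> b).
  Every vertex v other than the least one has a neighbour w \<prec> v dominating v in the
  subgraph induced by {u. u \<preceq> v}.\<close>
definition dismantlable :: "('a \<Rightarrow> 'a \<Rightarrow> bool) \<Rightarrow> bool" where
  "dismantlable E \<longleftrightarrow>
    (\<exists>r. Well_order r \<and> Field r = UNIV \<and>
      (\<forall>v. (\<exists>u. (u, v) \<in> r \<and> u \<noteq> v) \<longrightarrow>
         (\<exists>w. (w, v) \<in> r \<and> w \<noteq> v \<and> E w v \<and>
            (\<forall>x. (x, v) \<in> r \<and> (x = v \<or> E x v) \<longrightarrow> x = w \<or> E x w))))"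

text \<open>Geometric realisation of the clique complex X(G): finitely supported barycentric
  coordinate functions whose support is a (finite) clique, with the weak (CW) topology
  coherent with the Euclidean topology on each closed simplex.\<close>

definition realization :: "('a \<Rightarrow> 'a \<Rightarrow> bool) \<Rightarrow> ('a \<Rightarrow> real) set" where
  "realization E = {f. (\<forall>x. 0 \<le> f x) \<and> finite {x. f x \<noteq> 0} \<and> clique E {x. f x \<noteq> 0}
                        \<and> sum f {x. f x \<noteq> 0} = 1}"

definition closed_simplex :: "('a \<Rightarrow> 'a \<Rightarrow> bool) \<Rightarrow> 'a set \<Rightarrow> ('a \<Rightarrow> real) set" where
  "closed_simplex E \<sigma> = {f \<in> realization E. {x. f x \<noteq> 0} \<subseteq> \<sigma>}"

definition clique_complex_topology :: "('a \<Rightarrow> 'a \<Rightarrow> bool) \<Rightarrow> ('a \<Rightarrow> real) topology" where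
  "clique_complex_topology E = topology (\<lambda>U. U \<subseteq> realization E \<and>
     (\<forall>\<sigma>. finite \<sigma> \<and> clique E \<sigma> \<longrightarrow>
        openin (top_of_set (closed_simplex E \<sigma>)) (U \<inter> closed_simplex E \<sigma>)))"

lemma istopology_clique_complex:
  "istopology (\<lambda>U. U \<subseteq> realization E \<and>
     (\<forall>\<sigma>. finite \<sigma> \<and> clique E \<sigma> \<longrightarrow>
        openin (top_of_set (closed_simplex E \<sigma>)) (U \<inter> closed_simplex E \<sigma>)))"
  unfolding istopology_def
proof (rule conjI; intro allI impI)
  fix S T :: "('a \<Rightarrow> real) set"
  assume S: "S \<subseteq> realization E \<and> (\<forall>\<sigma>. finite \<sigma> \<and> clique E \<sigma> \<longrightarrow>
        openin (top_of_set (closed_simplex E \<sigma>)) (S \<inter> closed_simplex E \<sigma>))"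
     and T: "T \<subseteq> realization E \<and> (\<forall>\<sigma>. finite \<sigma> \<and> clique E \<sigma> \<longrightarrow>
        openin (top_of_set (closed_simplex E \<sigma>)) (T \<inter> closed_simplex E \<sigma>))"
  show "S \<inter> T \<subseteq> realization E \<and> (\<forall>\<sigma>. finite \<sigma> \<and> clique E \<sigma> \<longrightarrow>
        openin (top_of_set (closed_simplex E \<sigma>)) (S \<inter> T \<inter> closed_simplex E \<sigma>))"
  proof (intro conjI allI impI)
    show "S \<inter> T \<subseteq> realization E" using S by blast
    fix \<sigma> :: "'a set" assume h: "finite \<sigma> \<and> clique E \<sigma>"
    have "S \<inter> T \<inter> closed_simplex E \<sigma> = (S \<inter> closed_simplex E \<sigma>) \<inter> (T \<inter> closed_simplex E \<sigma>)"
      by blast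
    moreover have "openin (top_of_set (closed_simplex E \<sigma>)) (S \<inter> closed_simplex E \<sigma>)"
      using S h by blast
    moreover have "openin (top_of_set (closed_simplex E \<sigma>)) (T \<inter> closed_simplex E \<sigma>)"
      using T h by blast
    ultimately show "openin (top_of_set (closed_simplex E \<sigma>)) (S \<inter> T \<inter> closed_simplex E \<sigma>)"
      by (simp add: openin_Int)
  qed
next
  fix K :: "('a \<Rightarrow> real) set set"
  assume K: "\<forall>U\<in>K. U \<subseteq> realization E \<and> (\<forall>\<sigma>. finite \<sigma> \<and> clique E \<sigma> \<longrightarrow>
        openin (top_of_set (closed_simplex E \<sigma>)) (U \<inter> closed_simplex E \<sigma>))"
  show "\<Union>K \<subseteq> realization E \<and> (\<forall>\<sigma>. finite \<sigma> \<and> clique E \<sigma> \<longrightarrow>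
        openin (top_of_set (closed_simplex E \<sigma>)) (\<Union>K \<inter> closed_simplex E \<sigma>))"
  proof (intro conjI allI impI)
    show "\<Union>K \<subseteq> realization E" using K by blast
    fix \<sigma> :: "'a set" assume h: "finite \<sigma> \<and> clique E \<sigma>"
    have eq: "\<Union>K \<inter> closed_simplex E \<sigma> = \<Union>((\<lambda>U. U \<inter> closed_simplex E \<sigma>) ` K)" by blast
    show "openin (top_of_set (closed_simplex E \<sigma>)) (\<Union>K \<inter> closed_simplex E \<sigma>)"
      unfolding eq using K h by (intro openin_Union) auto
  qed
qed

lemma openin_clique_complex_topology:
  "openin (clique_complex_topology E) U \<longleftrightarrow> U \<subseteq> realization E \<and>
     (\<forall>\<sigma>. finite \<sigma> \<and> clique E \<sigma> \<longrightarrow>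
        openin (top_of_set (closed_simplex E \<sigma>)) (U \<inter> closed_simplex E \<sigma>))"
  unfolding clique_complex_topology_def
  by (rule topology_inverse' [OF istopology_clique_complex, THEN fun_cong])

text \<open>Simply connected topological space, mirroring the library's simply_connected
  (all loops are homotopic as loops) for abstract topologies.\<close>
definition simply_connected_space :: "'b topology \<Rightarrow> bool" where
  "simply_connected_space X \<longleftrightarrow>
     (\<forall>p q. pathin X p \<and> p 1 = p 0 \<and> pathin X q \<and> q 1 = q 0 \<longrightarrow>
        homotopic_with (\<lambda>r. r 1 = r 0) (top_of_set {0..1}) X p q)"

definition finite_dimensional_cc :: "('a \<Rightarrow> 'a \<Rightarrow> bool) \<Rightarrow> bool" where
  "finite_dimensional_cc E \<longleftrightarrow> (\<exists>n. \<forall>\<sigma>. finite \<sigma> \<and> clique E \<sigma> \<longrightarrow> card \<sigma> \<le> n)"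

end

theory Submission
  imports Defs
begin

text \<open>
  Everything is routed through one condition on breadth-first search: every vertex \<open>v\<close> at distance
  \<open>k + 1\<close> from \<open>u\<close> has a vertex \<open>w\<close> at distance \<open>k\<close> adjacent to all of \<open>B\<^sub>1(v) \<inter> B\<^sub>k\<^sub>+\<^sub>1(u)\<close>. A Helly
  graph has this property for every \<open>u\<close>: intersect \<open>B\<^sub>k(u)\<close> with the unit balls around the vertices
  of \<open>B\<^sub>1(v) \<inter> B\<^sub>k\<^sub>+\<^sub>1(u)\<close>. The property yields dismantlability, weak modularity, and retractions
  \<open>B\<^sub>k\<^sub>+\<^sub>1(u) \<rightarrow> B\<^sub>k(u)\<close> moving each clique inside a clique, which concatenate to a contraction of the
  whole clique complex; finite dimension plays no role.

  Conversely, if closed walks are null-homotopic through triangles and the graph is clique-Helly,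
  the universal cover is built level by level. A new vertex is a class of pairs \<open>(x, z)\<close>, where \<open>z\<close> is
  a neighbour of the image of the outermost vertex \<open>x\<close> which does not lift yet, and the clique-Helly
  property together with Zorn's lemma provides a dominating vertex for each class. Simple
  connectivity identifies the cover with the graph, so breadth-first search is dominated from every
  vertex. Finally a family of pairwise intersecting balls is shrunk by one unit at a time: among the
  common points of the balls of radius \<open>r + 1\<close>, a point maximal for inclusion of its unit ball and of
  the set of balls of radius \<open>r\<close> containing it lies in all of the latter.
\<close>

section \<open>Zorn's lemma for preorders\<close>

text \<open>Principal down-sets turn the preorder into inclusion and identify equivalent elements.
  Maximality up to equivalence is the right notion here: the orders used later compare sets of
  neighbours and need not be antisymmetric.\<close>

lemma preorder_Zorn:
  assumes "P \<noteq> {}"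
    and refl: "\<And>x. x \<in> P \<Longrightarrow> le x x"
    and trans: "\<And>x y z. \<lbrakk>x \<in> P; y \<in> P; z \<in> P; le x y; le y z\<rbrakk> \<Longrightarrow> le x z"
    and ub: "\<And>C. \<lbrakk>C \<subseteq> P; C \<noteq> {}; \<And>x y. \<lbrakk>x \<in> C; y \<in> C\<rbrakk> \<Longrightarrow> le x y \<or> le y x\<rbrakk>
               \<Longrightarrow> \<exists>q\<in>P. \<forall>x\<in>C. le x q"
  shows "\<exists>m\<in>P. \<forall>x\<in>P. le m x \<longrightarrow> le x m"
proof -
  define dn where "dn p = {x \<in> P. le x p}" for p
  have dn_le: "dn x \<subseteq> dn y \<longleftrightarrow> le x y" if "x \<in> P" "y \<in> P" for x y
    using that refl trans unfolding dn_def by blast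
  have "\<exists>M\<in>dn ` P. \<forall>X\<in>dn ` P. M \<subseteq> X \<longrightarrow> X = M"
  proof (rule subset_Zorn)
    fix K assume K: "subset.chain (dn ` P) K"
    define C where "C = {p \<in> P. dn p \<in> K}"
    show "\<exists>U\<in>dn ` P. \<forall>X\<in>K. X \<subseteq> U"
    proof (cases "C = {}")
      case True
      with K have "K = {}"
        unfolding C_def subset.chain_def by blast
      with \<open>P \<noteq> {}\<close> show ?thesis by blast
    next
      case False
      have "le x y \<or> le y x" if "x \<in> C" "y \<in> C" for x y
      proof -
        have "dn x \<subseteq> dn y \<or> dn y \<subseteq> dn x"
          using K that unfolding C_def subset.chain_def by blast
        then show ?thesis using that dn_le unfolding C_def by blast
      qed
      with ub[of C] False obtain q where q: "q \<in> P" "\<forall>x\<in>C. le x q"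
        unfolding C_def by blast
      have "X \<subseteq> dn q" if X: "X \<in> K" for X
      proof -
        obtain p where "p \<in> P" "X = dn p" using K X unfolding subset.chain_def by blast
        then show ?thesis using X q dn_le unfolding C_def by blast
      qed
      with q show ?thesis by blast
    qed
  qed
  then obtain m where "m \<in> P" and m: "\<forall>X\<in>dn ` P. dn m \<subseteq> X \<longrightarrow> X = dn m" by blast
  have "le x m" if "x \<in> P" "le m x" for x
    using that m \<open>m \<in> P\<close> dn_le[of m x] dn_le[of x m] by blast
  with \<open>m \<in> P\<close> show ?thesis by blast
qed

section \<open>Graph distance and cliques\<close>

text \<open>Retractions and domination may identify vertices, so degenerate edges and triangles have
  to be allowed throughout.\<close>

definition near :: "('a \<Rightarrow> 'a \<Rightarrow> bool) \<Rightarrow> 'a \<Rightarrow> 'a \<Rightarrow> bool" where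
  "near E x y \<longleftrightarrow> x = y \<or> E x y"

definition BFS_dominated :: "('a \<Rightarrow> 'a \<Rightarrow> bool) \<Rightarrow> 'a \<Rightarrow> bool" where
  "BFS_dominated E u \<longleftrightarrow> (\<forall>v. v \<noteq> u \<longrightarrow>
     (\<exists>w. gdist E u v = Suc (gdist E u w) \<and>
          (\<forall>x. near E v x \<and> gdist E u x \<le> gdist E u v \<longrightarrow> near E w x)))"

locale connected_graph =
  fixes E :: "'a \<Rightarrow> 'a \<Rightarrow> bool"
  assumes sym: "E x y \<Longrightarrow> E y x" and irrefl: "\<not> E x x" and conn: "gconnected E"
begin

abbreviation nb where "nb \<equiv> near E"
abbreviation d where "d \<equiv> gdist E"

lemma nb_refl [simp]: "nb x x"
  by (simp add: near_def)

lemma nb_sym: "nb x y \<Longrightarrow> nb y x"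
  by (auto simp: near_def sym)

lemma gdist_relpow: "(u, v) \<in> {(x, y). E x y} ^^ d u v"
proof -
  have "\<exists>n. (u, v) \<in> {(x, y). E x y} ^^ n"
    using conn rtrancl_power unfolding gconnected_def by blast
  then show ?thesis unfolding gdist_def by (rule LeastI_ex)
qed

lemma gdist_le: "(u, v) \<in> {(x, y). E x y} ^^ n \<Longrightarrow> d u v \<le> n"
  unfolding gdist_def by (rule Least_le)

lemma gdist_self [simp]: "d u u = 0"
  using gdist_le[of u u 0] by simp

lemma gdist_eq_0 [simp]: "d u v = 0 \<longleftrightarrow> u = v"
  using gdist_relpow[of u v] by auto

lemma gdist_triangle: "d u w \<le> d u v + d v w"
  by (rule gdist_le) (use gdist_relpow relpow_add in blast)

lemma relpow_sym: "(u, v) \<in> {(x, y). E x y} ^^ n \<Longrightarrow> (v, u) \<in> {(x, y). E x y} ^^ n"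
proof (induction n arbitrary: v)
  case (Suc n)
  then obtain w where "(u, w) \<in> {(x, y). E x y} ^^ n" "E w v" by auto
  with Suc.IH sym show ?case by (intro relpow_Suc_I2[of _ w]) auto
qed simp

lemma gdist_sym: "d u v = d v u"
  by (rule antisym; rule gdist_le, rule relpow_sym, rule gdist_relpow)

lemma gdist_le_1: "d u v \<le> 1 \<longleftrightarrow> nb u v"
proof
  assume "d u v \<le> 1"
  then have "d u v = 0 \<or> d u v = 1" by linarith
  then show "nb u v"
    using gdist_relpow[of u v] by (auto simp: near_def)
next
  assume "nb u v"
  then show "d u v \<le> 1"
    using gdist_le[of u v 1] by (auto simp: near_def)
qed

lemma nb_gdist: "nb x y \<Longrightarrow> d u y \<le> Suc (d u x)"
  using gdist_triangle[of u y x] gdist_le_1[of x y] by simp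

lemma gdist_split:
  assumes "d u v \<le> i + j"
  shows "\<exists>w. d u w \<le> i \<and> d w v \<le> j"
proof (cases "d u v \<le> i")
  case True
  then show ?thesis by (intro exI[of _ v]) simp
next
  case False
  then have "(u, v) \<in> {(x, y). E x y} ^^ (i + (d u v - i))"
    using gdist_relpow by simp
  then obtain w where "(u, w) \<in> {(x, y). E x y} ^^ i" "(w, v) \<in> {(x, y). E x y} ^^ (d u v - i)"
    unfolding relpow_add by blast
  with gdist_le assms show ?thesis by (metis le_diff_conv add.commute order_trans)
qed

lemma gdist_Suc_nb:
  assumes "d u v \<le> Suc i"
  shows "\<exists>w. d u w \<le> i \<and> nb w v"
  using gdist_split[of u v i 1] assms gdist_le_1 by auto

lemma gball_1: "x \<in> gball E 1 v \<longleftrightarrow> nb v x"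
  by (simp only: gball_def mem_Collect_eq gdist_le_1)

lemma clique_near: "clique E C \<longleftrightarrow> (\<forall>x\<in>C. \<forall>y\<in>C. nb x y)"
  unfolding clique_def near_def by blast

lemma clique_insert: "clique E (insert a C) \<longleftrightarrow> clique E C \<and> (\<forall>p\<in>C. nb a p)"
  unfolding clique_near using nb_sym by (metis insert_iff nb_refl)

lemma clique_extend:
  assumes "clique E C"
  shows "\<exists>M. maximal_clique E M \<and> C \<subseteq> M"
proof -
  have "\<exists>M\<in>{D. clique E D \<and> C \<subseteq> D}. \<forall>X\<in>{D. clique E D \<and> C \<subseteq> D}. M \<subseteq> X \<longrightarrow> X = M"
  proof (rule subset_Zorn_nonempty)
    fix K assume "K \<noteq> {}" and K: "subset.chain {D. clique E D \<and> C \<subseteq> D} K"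
    then have sub: "K \<subseteq> {D. clique E D \<and> C \<subseteq> D}" and
      lin: "\<And>X Y. X \<in> K \<Longrightarrow> Y \<in> K \<Longrightarrow> X \<subseteq> Y \<or> Y \<subseteq> X"
      unfolding subset.chain_def by blast+
    have "nb x y" if xy: "x \<in> \<Union>K" "y \<in> \<Union>K" for x y
    proof -
      obtain X Y where "X \<in> K" "Y \<in> K" "x \<in> X" "y \<in> Y" using xy by blast
      then show ?thesis using lin[of X Y] sub unfolding clique_near by blast
    qed
    then have "clique E (\<Union>K)" by (simp add: clique_near)
    moreover obtain X where "X \<in> K" using \<open>K \<noteq> {}\<close> by auto
    then have "C \<subseteq> \<Union>K" using sub by auto
    ultimately show "\<Union>K \<in> {D. clique E D \<and> C \<subseteq> D}" by blast
  qed (use assms in auto)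
  then obtain M where "clique E M" "C \<subseteq> M" "\<And>X. \<lbrakk>clique E X; C \<subseteq> X; M \<subseteq> X\<rbrakk> \<Longrightarrow> X = M" by auto
  then show ?thesis unfolding maximal_clique_def by (meson order_trans)
qed

text \<open>The property is applied to all maximal cliques containing some member of
  \<open>K\<close>. A common vertex lies in a maximal clique around each member, hence is near all
  vertices of that member.\<close>

lemma clique_Helly_common:
  assumes "clique_Helly E"
    and cl: "\<And>C. C \<in> K \<Longrightarrow> clique E C"
    and meet: "\<And>C D. \<lbrakk>C \<in> K; D \<in> K\<rbrakk> \<Longrightarrow> C \<inter> D \<noteq> {}"
  shows "\<exists>q. \<forall>C\<in>K. \<forall>x\<in>C. nb q x"
proof -
  define S where "S = {M. maximal_clique E M \<and> (\<exists>C\<in>K. C \<subseteq> M)}"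
  have "\<forall>A\<in>S. \<forall>B\<in>S. A \<inter> B \<noteq> {}"
    unfolding S_def using meet by blast
  moreover have "S \<subseteq> {C. maximal_clique E C}" unfolding S_def by blast
  ultimately have "\<Inter>S \<noteq> {}"
    using assms(1) unfolding clique_Helly_def Helly_family_def by blast
  then obtain q where q: "\<And>M. M \<in> S \<Longrightarrow> q \<in> M" by blast
  have "nb q x" if C: "C \<in> K" "x \<in> C" for C x
  proof -
    obtain M where M: "maximal_clique E M" "C \<subseteq> M" using clique_extend cl C by blast
    with C q have "q \<in> M" unfolding S_def by blast
    with M C show ?thesis unfolding maximal_clique_def clique_near by blast
  qed
  then show ?thesis by blast
qed

section \<open>Radial retractions and the Helly property\<close>

definition dominator :: "'a \<Rightarrow> 'a \<Rightarrow> 'a" where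
  "dominator u v = (SOME w. d u v = Suc (d u w) \<and>
     (\<forall>x. nb v x \<and> d u x \<le> d u v \<longrightarrow> nb w x))"

lemma dominator:
  assumes "BFS_dominated E u" "v \<noteq> u"
  shows "d u v = Suc (d u (dominator u v))"
    and "\<lbrakk>nb v x; d u x \<le> d u v\<rbrakk> \<Longrightarrow> nb (dominator u v) x"
proof -
  let ?P = "\<lambda>w. d u v = Suc (d u w) \<and> (\<forall>x. nb v x \<and> d u x \<le> d u v \<longrightarrow> nb w x)"
  have "\<exists>w. ?P w" using assms unfolding BFS_dominated_def by blast
  then have *: "?P (dominator u v)" unfolding dominator_def by (rule someI_ex)
  show "d u v = Suc (d u (dominator u v))" using * by blast
  show "\<lbrakk>nb v x; d u x \<le> d u v\<rbrakk> \<Longrightarrow> nb (dominator u v) x" using * by blast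
qed

text \<open>Truncated subtraction makes this a retraction onto the ball of radius \<open>j\<close>
  about \<open>u\<close>: vertices inside are moved zero times.\<close>

definition radial :: "'a \<Rightarrow> nat \<Rightarrow> 'a \<Rightarrow> 'a" where
  "radial u j v = (dominator u ^^ (d u v - j)) v"

lemma radial_id: "d u v \<le> j \<Longrightarrow> radial u j v = v"
  by (simp add: radial_def)

context
  fixes u assumes dom: "BFS_dominated E u"
begin

lemma gdist_funpow_dominator: "i \<le> d u v \<Longrightarrow> d u ((dominator u ^^ i) v) = d u v - i"
proof (induction i)
  case (Suc i)
  then have IH: "d u ((dominator u ^^ i) v) = d u v - i" by simp
  with Suc.prems have "(dominator u ^^ i) v \<noteq> u" using gdist_self by fastforce
  from dominator(1)[OF dom this] IH show ?case by simp
qed simp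

lemma gdist_radial: "d u (radial u j v) = min j (d u v)"
  unfolding radial_def using gdist_funpow_dominator[of "d u v - j" v] by auto

lemma radial_step:
  "j < d u v \<Longrightarrow> radial u j v = dominator u (radial u (Suc j) v)"
  unfolding radial_def by (metis Suc_diff_Suc funpow.simps(2) o_apply)

text \<open>Descending induction from a level where both retractions are the identity: the first
  half at \<open>Suc j\<close> gives the second at \<open>j\<close>, which gives the first at
  \<open>j\<close>. Together they make the images of a clique at two consecutive levels a single
  clique.\<close>

lemma radial_near:
  assumes "nb x y"
  shows "nb (radial u j x) (radial u j y) \<and> nb (radial u (Suc j) x) (radial u j y)"
proof -
  define N where "N = max (d u x) (d u y)"
  have down: "nb a (radial u j y')"
    if "nb a (radial u (Suc j) y')" "d u a \<le> Suc j" for a y' j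
  proof (cases "d u y' \<le> j")
    case True
    with that show ?thesis by (simp add: radial_id)
  next
    case False
    then have *: "d u (radial u (Suc j) y') = Suc j" by (simp add: gdist_radial)
    then have "radial u (Suc j) y' \<noteq> u" by auto
    from dominator(2)[OF dom this nb_sym[OF that(1)]] False * that(2)
    show ?thesis by (simp add: radial_step nb_sym)
  qed
  show ?thesis
  proof (cases "j \<le> N")
    case True
    then show ?thesis
    proof (induction j rule: inc_induct)
      case base
      then show ?case using assms by (simp add: radial_id N_def)
    next
      case (step j)
      have 1: "nb (radial u (Suc j) x) (radial u j y)"
        by (rule down) (use step in \<open>auto simp: gdist_radial\<close>)
      have "nb (radial u j y) (radial u j x)"
        by (rule down) (use 1 in \<open>auto simp: gdist_radial nb_sym\<close>)
      with 1 show ?case by (simp add: nb_sym)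
    qed
  next
    case False
    then show ?thesis using assms by (simp add: radial_id N_def)
  qed
qed

text \<open>Along a geodesic the level may drop by one at each step: by the second half of
  \<open>radial_near\<close> such a slanted step still has length at most one.\<close>

lemma gdist_radial_le:
  "d x y \<le> i \<Longrightarrow> d (radial u (j + i) x) (radial u j y) \<le> i"
proof (induction i arbitrary: j y)
  case (Suc i)
  then obtain y' where y': "d x y' \<le> i" "nb y' y" using gdist_Suc_nb by blast
  have "d (radial u (Suc j + i) x) (radial u (Suc j) y') \<le> i"
    using Suc.IH[OF y'(1)] .
  moreover have "nb (radial u (Suc j) y') (radial u j y)"
    using radial_near[OF y'(2)] by blast
  then have "d (radial u (Suc j + i) x) (radial u j y) \<le> Suc (d (radial u (Suc j + i) x) (radial u (Suc j) y'))"
    by (rule nb_gdist)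
  ultimately show ?case by simp
qed simp

text \<open>The point of the triple intersection is the image under the radial retraction onto the
  unit ball of a point dividing a geodesic from \<open>x\<close> to \<open>y\<close>.\<close>
lemma three_balls:
  assumes "d u x \<le> Suc r" "d u y \<le> Suc s" "d x y \<le> r + s"
  shows "\<exists>e. nb u e \<and> d e x \<le> r \<and> d e y \<le> s"
proof -
  obtain g where g: "d x g \<le> r" "d g y \<le> s" using gdist_split[OF assms(3)] by blast
  let ?e = "radial u 1 g"
  have "d u ?e \<le> 1" by (simp add: gdist_radial)
  then have "nb u ?e" by (simp only: gdist_le_1)
  moreover have "d ?e x \<le> r"
    using gdist_radial_le[OF g(1), of 1] assms(1) by (simp add: radial_id gdist_sym)
  moreover have "d ?e y \<le> s"
    using gdist_radial_le[of y g s 1] g(2) assms(2) by (simp add: radial_id gdist_sym)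
  ultimately show ?thesis by blast
qed

text \<open>The dominator of a member at distance exactly \<open>Suc r\<close> is near the whole
  clique. Without such a member any vertex of \<open>C\<close> serves, or \<open>u\<close> when
  \<open>C\<close> is empty.\<close>

lemma clique_dominated:
  assumes "clique E C" and ball: "\<And>x. x \<in> C \<Longrightarrow> d u x \<le> Suc r"
  shows "\<exists>c. d u c \<le> r \<and> (\<forall>x\<in>C. nb c x)"
proof (cases "\<exists>p\<in>C. d u p = Suc r")
  case True
  then obtain p where p: "p \<in> C" "d u p = Suc r" by blast
  then have "p \<noteq> u" by auto
  from dominator[OF dom this] p assms show ?thesis
    by (intro exI[of _ "dominator u p"]) (auto simp: clique_near)
next
  case False
  then have le: "d u x \<le> r" if "x \<in> C" for x using ball that by (metis le_SucE)
  show ?thesis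
  proof (cases "C = {}")
    case True
    then show ?thesis by (intro exI[of _ u]) simp
  next
    case False
    then show ?thesis using le assms(1) unfolding clique_near by blast
  qed
qed

end

lemma Helly_step:
  assumes ch: "clique_Helly E" and dom: "\<And>u. BFS_dominated E u"
    and F: "\<And>x r y s. \<lbrakk>(x, r) \<in> F; (y, s) \<in> F\<rbrakk> \<Longrightarrow> d x y \<le> r + s"
    and q0: "\<And>x r. (x, r) \<in> F \<Longrightarrow> d x q0 \<le> Suc r"
  shows "\<exists>q. \<forall>(x, r)\<in>F. d x q \<le> r"
proof (cases "\<exists>x. (x, 0) \<in> F")
  case True
  \<comment> \<open>A ball of radius 0 leaves only its centre, which lies in all other balls by
    \<open>F\<close>. In the other case all radii are positive.\<close>
  then obtain x where "(x, 0) \<in> F" by blast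
  with F show ?thesis by fastforce
next
  case False
  define Q where "Q = {q. \<forall>(x, r)\<in>F. d x q \<le> Suc r}"
  \<comment> \<open>Growth of \<open>B\<close> makes comparable points adjacent, so that chains are
    cliques; growth of \<open>I\<close> records the balls already reached.\<close>
  define B where "B q = {t \<in> Q. nb q t}" for q
  define I where "I q = {(x, r). (x, r) \<in> F \<and> d x q \<le> r}" for q
  define le where "le p q \<longleftrightarrow> B p \<subseteq> B q \<and> I p \<subseteq> I q" for p q
  have le_nb: "nb p q" if "le p q" "p \<in> Q" for p q
    using that nb_sym unfolding le_def B_def by auto
  have "\<exists>m\<in>Q. \<forall>x\<in>Q. le m x \<longrightarrow> le x m"
  proof (rule preorder_Zorn)
    show "Q \<noteq> {}" using q0 unfolding Q_def by blast
    show "le x x" for x by (simp add: le_def)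
    show "le x z" if "le x y" "le y z" for x y z using that unfolding le_def by blast
    fix C assume CQ: "C \<subseteq> Q" and "C \<noteq> {}"
      and lin: "\<And>x y. \<lbrakk>x \<in> C; y \<in> C\<rbrakk> \<Longrightarrow> le x y \<or> le y x"
    have CC: "nb p q" if "p \<in> C" "q \<in> C" for p q
      using lin[OF that] le_nb CQ that nb_sym by blast
    \<comment> \<open>The target is one unit deeper, at radius \<open>r - 1\<close>, so that a
      vertex near \<open>c\<close> is still within \<open>r\<close> of \<open>x\<close>. The points
      \<open>b\<close> below do the same for the enlarged balls.\<close>
    have "\<exists>c. (x, r) \<in> F \<longrightarrow> d x c \<le> r - 1 \<and> (\<forall>p\<in>C. (x, r) \<in> I p \<longrightarrow> nb c p)" for x r
    proof (cases "(x, r) \<in> F")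
      case True
      with False have "r > 0" by (metis gr0I)
      have "\<exists>c. d x c \<le> r - 1 \<and> (\<forall>p\<in>{p\<in>C. (x, r) \<in> I p}. nb c p)"
        by (rule clique_dominated) (use dom CC \<open>r > 0\<close> in \<open>auto simp: clique_near I_def\<close>)
      then show ?thesis by blast
    qed blast
    then obtain c where c: "\<And>x r. (x, r) \<in> F \<Longrightarrow> d x (c x r) \<le> r - 1"
      "\<And>x r p. \<lbrakk>(x, r) \<in> F; p \<in> C; (x, r) \<in> I p\<rbrakk> \<Longrightarrow> nb (c x r) p"
      by metis
    have "\<exists>c. (x, r) \<in> F \<longrightarrow> d x c \<le> r \<and> (\<forall>p\<in>C. nb c p)" for x r
    proof (cases "(x, r) \<in> F")
      case True
      have "\<exists>c. d x c \<le> r \<and> (\<forall>p\<in>C. nb c p)"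
        by (rule clique_dominated) (use dom CC True CQ in \<open>auto simp: clique_near Q_def\<close>)
      then show ?thesis by blast
    qed blast
    then obtain b where b: "\<And>x r. (x, r) \<in> F \<Longrightarrow> d x (b x r) \<le> r"
      "\<And>x r p. \<lbrakk>(x, r) \<in> F; p \<in> C\<rbrakk> \<Longrightarrow> nb (b x r) p"
      by metis
    \<comment> \<open>The cliques encode what an upper bound \<open>q\<close> has to satisfy:
      nearness to \<open>t\<close> gives \<open>B p \<subseteq> B q\<close>, to \<open>c x r\<close>
      gives \<open>I p \<subseteq> I q\<close>, and to \<open>b x r\<close> gives
      \<open>q \<in> Q\<close>.\<close>
    let ?K1 = "{insert t {p\<in>C. t \<in> B p} | t. t \<in> (\<Union>p\<in>C. B p)}"
    let ?K2 = "{insert (c x r) {p\<in>C. (x, r) \<in> I p} | x r. (x, r) \<in> (\<Union>p\<in>C. I p)}"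
    let ?K3 = "{insert (b x r) C | x r. (x, r) \<in> F}"
    have "\<exists>q. \<forall>C\<in>?K1 \<union> ?K2 \<union> ?K3. \<forall>x\<in>C. nb q x"
    proof (rule clique_Helly_common[OF ch])
      have ins: "clique E (insert a A)" if "A \<subseteq> C" "\<And>p. p \<in> A \<Longrightarrow> nb a p" for a A
        unfolding clique_insert using that CC by (simp add: clique_near subset_iff)
      fix X assume "X \<in> ?K1 \<union> ?K2 \<union> ?K3"
      then consider t where "X = insert t {p\<in>C. t \<in> B p}"
        | x r p where "X = insert (c x r) {p\<in>C. (x, r) \<in> I p}" "(x, r) \<in> I p"
        | x r where "X = insert (b x r) C" "(x, r) \<in> F"
        by (elim UnE CollectE exE conjE UN_E) auto
      then show "clique E X"
      proof cases
        case 1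
        show ?thesis unfolding 1 by (intro ins) (auto simp: B_def nb_sym)
      next
        case 2
        then have "(x, r) \<in> F" by (simp add: I_def)
        then show ?thesis unfolding 2(1) by (intro ins) (use c(2) in auto)
      next
        case 3
        show ?thesis unfolding 3(1) by (intro ins) (use b(2) 3(2) in auto)
      qed
    next
      fix X Y assume XY: "X \<in> ?K1 \<union> ?K2 \<union> ?K3" "Y \<in> ?K1 \<union> ?K2 \<union> ?K3"
      \<comment> \<open>Every such clique contains a final segment of the chain, and two final
        segments of a chain meet.\<close>
      have up: "\<exists>p\<in>C. \<forall>p'\<in>C. le p p' \<longrightarrow> p' \<in> Z" if "Z \<in> ?K1 \<union> ?K2 \<union> ?K3" for Z
        using that \<open>C \<noteq> {}\<close> unfolding le_def by blast
      obtain p p' where p: "p \<in> C" "\<forall>y\<in>C. le p y \<longrightarrow> y \<in> X" "p' \<in> C" "\<forall>y\<in>C. le p' y \<longrightarrow> y \<in> Y"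
        using up[OF XY(1)] up[OF XY(2)] by blast
      moreover have "le p p" "le p' p'" by (simp_all add: le_def)
      ultimately show "X \<inter> Y \<noteq> {}" using lin[of p p'] by blast
    qed
    then obtain q where q: "\<forall>C\<in>?K1 \<union> ?K2 \<union> ?K3. \<forall>x\<in>C. nb q x" ..
    have q1: "nb q t" if "p \<in> C" "t \<in> B p" for p t
      using bspec[OF q, of "insert t {p\<in>C. t \<in> B p}"] that by blast
    have q2: "nb q (c x r)" if "p \<in> C" "(x, r) \<in> I p" for p x r
      using bspec[OF q, of "insert (c x r) {p\<in>C. (x, r) \<in> I p}"] that by blast
    have q3: "nb q (b x r)" if "(x, r) \<in> F" for x r
      using bspec[OF q, of "insert (b x r) C"] that by blast
    have "q \<in> Q"
      unfolding Q_def
    proof clarify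
      fix x r assume xr: "(x, r) \<in> F"
      then have "nb q (b x r)" by (rule q3)
      then show "d x q \<le> Suc r" using nb_gdist[of "b x r" q x] b(1)[OF xr] nb_sym by fastforce
    qed
    moreover have "le p q" if "p \<in> C" for p
      unfolding le_def
    proof
      show "B p \<subseteq> B q"
      proof
        fix t assume t: "t \<in> B p"
        then have "nb q t" using that q1 by blast
        with t show "t \<in> B q" unfolding B_def by blast
      qed
      show "I p \<subseteq> I q"
      proof clarify
        fix x r assume xr: "(x, r) \<in> I p"
        then have F: "(x, r) \<in> F" by (simp add: I_def)
        with False have "r > 0" by (metis gr0I)
        have "nb q (c x r)" using q2 that xr by blast
        then have "d x q \<le> Suc (d x (c x r))" using nb_gdist nb_sym by blast
        then show "(x, r) \<in> I q" using c(1)[OF F] \<open>r > 0\<close> F unfolding I_def by auto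
      qed
    qed
    ultimately show "\<exists>q\<in>Q. \<forall>x\<in>C. le x q" by blast
  qed
  then obtain m where mQ: "m \<in> Q" and max: "\<And>x. x \<in> Q \<Longrightarrow> le m x \<Longrightarrow> le x m" by blast
  have "d x m \<le> r" if xr: "(x, r) \<in> F" for x r
  proof (rule ccontr)
    assume far: "\<not> d x m \<le> r"
    with mQ xr have dm: "d x m = Suc r" unfolding Q_def by fastforce
    then have "m \<noteq> x" by auto
    \<comment> \<open>Moving from \<open>m\<close> to its dominator towards \<open>x\<close> reaches
      the missed ball and loses nothing, against maximality.\<close>
    define p where "p = dominator x m"
    have p: "d x p = r" "\<And>y. \<lbrakk>nb m y; d x y \<le> Suc r\<rbrakk> \<Longrightarrow> nb p y"
      using dominator[OF dom \<open>m \<noteq> x\<close>] dm unfolding p_def by auto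
    \<comment> \<open>Needed with \<open>s' = Suc s\<close> for membership in \<open>Q\<close> and
      with \<open>s' = s\<close> for \<open>I\<close>. The vertex \<open>e\<close> near
      \<open>m\<close> is one unit closer to \<open>y\<close> than \<open>s'\<close> and still
      within \<open>Suc r\<close> of \<open>x\<close>, so it is near \<open>p\<close>.\<close>
    have near_p: "d y p \<le> s'" if ys: "(y, s) \<in> F" "d y m \<le> s'" "s \<le> s'" for y s s'
    proof (cases s')
      case 0
      then show ?thesis using ys F[OF xr ys(1)] dm by simp
    next
      case (Suc k)
      have "d x y \<le> Suc r + k" using F[OF xr ys(1)] ys Suc by simp
      then obtain e where "nb m e" "d e x \<le> Suc r" "d e y \<le> k"
        using three_balls[OF dom, of m x "Suc r" y k] dm ys Suc by (auto simp: gdist_sym)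
      with p(2) have "nb e p" by (simp add: gdist_sym nb_sym)
      with nb_gdist[of e p y] \<open>d e y \<le> k\<close> Suc show ?thesis by (simp add: gdist_sym)
    qed
    have "p \<in> Q"
      using near_p mQ unfolding Q_def by fastforce
    moreover have "le m p"
      unfolding le_def
    proof
      show "B m \<subseteq> B p" using p(2) xr unfolding B_def Q_def by fastforce
      show "I m \<subseteq> I p" using near_p unfolding I_def by fastforce
    qed
    ultimately have "I p \<subseteq> I m" using max unfolding le_def by blast
    moreover have "(x, r) \<in> I p" using xr p(1) unfolding I_def by simp
    ultimately show False using far unfolding I_def by blast
  qed
  then show ?thesis by blast
qed

theorem Helly_if_dominated:
  assumes ch: "clique_Helly E" and dom: "\<And>u. BFS_dominated E u"
  shows "Helly E"
  unfolding Helly_def Helly_family_def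
proof clarify
  fix S assume S: "S \<subseteq> {gball E r v | r v. True}" "\<forall>A\<in>S. \<forall>B\<in>S. A \<inter> B \<noteq> {}" "\<Inter>S = {}"
  define F where "F = {(x, r). gball E r x \<in> S}"
  have F: "d x y \<le> r + s" if xy: "(x, r) \<in> F" "(y, s) \<in> F" for x r y s
  proof -
    have "gball E r x \<inter> gball E s y \<noteq> {}" using S(2) xy unfolding F_def by blast
    then obtain z where "d x z \<le> r" "d y z \<le> s" unfolding gball_def by blast
    then show ?thesis using gdist_triangle[of x y z] gdist_sym[of y z] by linarith
  qed
  \<comment> \<open>\<open>Helly_step\<close> for the family inflated by \<open>k\<close> lowers the
    excess from \<open>Suc k\<close> to \<open>k\<close>. The descent can start at the centre of any
    ball, with its radius as excess.\<close>
  have red: "\<exists>q. \<forall>(x, r)\<in>F. d x q \<le> r" if "\<And>x r. (x, r) \<in> F \<Longrightarrow> d x q \<le> r + k" for q k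
    using that
  proof (induction k arbitrary: q)
    case (Suc k)
    have "\<exists>q. \<forall>(x, r)\<in>{(x, r + k) | x r. (x, r) \<in> F}. d x q \<le> r"
      by (rule Helly_step[OF ch dom, of _ q]) (use F Suc.prems in fastforce)+
    then obtain q' where "\<And>x r. (x, r) \<in> F \<Longrightarrow> d x q' \<le> r + k" by blast
    then show ?case by (rule Suc.IH)
  qed auto
  have "\<exists>q. \<forall>(x, r)\<in>F. d x q \<le> r"
  proof (cases "F = {}")
    case False
    then obtain y s where ys: "(y, s) \<in> F" by auto
    show ?thesis by (rule red[of y s]) (use F[OF _ ys] in simp)
  qed simp
  then obtain q where q: "\<And>x r. (x, r) \<in> F \<Longrightarrow> d x q \<le> r" by blast
  have "q \<in> A" if A: "A \<in> S" for A
  proof -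
    obtain r v where "A = gball E r v" using S(1) A by blast
    with A q show ?thesis unfolding F_def gball_def by blast
  qed
  with S(3) show False by blast
qed

end

section \<open>Combinatorial homotopy of walks\<close>

context connected_graph
begin

text \<open>Edge-path homotopy in the clique complex. Triangles may be degenerate: the case
  \<open>c = a\<close> followed by a stutter removes a backtracking.\<close>

inductive htp :: "'a list \<Rightarrow> 'a list \<Rightarrow> bool" where
  htp_triangle: "\<lbrakk>nb a b; nb b c; nb a c\<rbrakk> \<Longrightarrow> htp (xs @ [a, b, c] @ ys) (xs @ [a, c] @ ys)"
| htp_stutter: "htp (xs @ [a, a] @ ys) (xs @ [a] @ ys)"
| htp_refl: "htp xs xs"
| htp_sym: "htp xs ys \<Longrightarrow> htp ys xs"
| htp_trans: "\<lbrakk>htp xs ys; htp ys zs\<rbrakk> \<Longrightarrow> htp xs zs"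

declare htp_refl [simp] htp_trans [trans]

abbreviation walk :: "'a list \<Rightarrow> bool" where
  "walk \<equiv> successively nb"

definition simply_conn :: bool where
  "simply_conn \<longleftrightarrow> (\<forall>xs. xs \<noteq> [] \<and> walk xs \<and> last xs = hd xs \<longrightarrow> htp xs [hd xs])"

lemma htp_append: "htp xs ys \<Longrightarrow> htp (us @ xs @ vs) (us @ ys @ vs)"
proof (induction rule: htp.induct)
  case (htp_triangle a b c xs ys)
  then show ?case using htp.htp_triangle[of a b c "us @ xs" "ys @ vs"] by simp
next
  case (htp_stutter xs a ys)
  then show ?case using htp.htp_stutter[of "us @ xs" a "ys @ vs"] by simp
next
  case (htp_trans xs ys zs)
  then show ?case using htp.htp_trans by blast
qed (auto intro: htp.htp_sym)

lemmas htp_append_left = htp_append[where vs = "[]", simplified]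
lemmas htp_append_right = htp_append[where us = "[]", simplified]

lemma htp_backtrack: "nb a b \<Longrightarrow> htp [a, b, a] [a]"
  using htp_triangle[of a b a "[]" "[]"] htp_stutter[of "[]" a "[]"] htp_trans nb_sym
  by (metis append.left_neutral append_Nil2 nb_refl)

section \<open>Coverings\<close>

end

text \<open>A covering of 2-dimensional complexes, \<open>A\<close> being the reflexive adjacency
  upstairs. Lifts of an edge from a given start are unique: two of them are adjacent by
  \<open>A_tri\<close> and then equal by \<open>A_inj\<close>.\<close>

locale triangle_cover = connected_graph E for E :: "'a \<Rightarrow> 'a \<Rightarrow> bool" +
  fixes V :: "'b set" and A :: "'b \<Rightarrow> 'b \<Rightarrow> bool" and f :: "'b \<Rightarrow> 'a"
  assumes A_hom: "A x y \<Longrightarrow> x \<in> V \<and> y \<in> V \<and> nb (f x) (f y)"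
    and A_refl: "x \<in> V \<Longrightarrow> A x x"
    and A_sym: "A x y \<Longrightarrow> A y x"
    and A_inj: "\<lbrakk>A x y; f x = f y\<rbrakk> \<Longrightarrow> x = y"
    and A_tri: "\<lbrakk>A x y; A x y'; nb (f y) (f y')\<rbrakk> \<Longrightarrow> A y y'"
    and A_lift: "\<lbrakk>x \<in> V; nb (f x) z\<rbrakk> \<Longrightarrow> \<exists>y. A x y \<and> f y = z"
begin

text \<open>The lifted walk itself is hidden; homotopy lifting only needs its end points
  \<open>h\<close> and \<open>h'\<close>.\<close>

fun lifts :: "'a list \<Rightarrow> 'b \<Rightarrow> 'b \<Rightarrow> bool" where
  "lifts [] h h' \<longleftrightarrow> False"
| "lifts [a] h h' \<longleftrightarrow> h \<in> V \<and> f h = a \<and> h = h'"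
| "lifts (a # b # xs) h h' \<longleftrightarrow> f h = a \<and> (\<exists>g. A h g \<and> lifts (b # xs) g h')"

lemma lifts_Cons:
  "lifts (a # ys) h h' \<longleftrightarrow> f h = a \<and> (if ys = [] then h \<in> V \<and> h = h' else \<exists>g. A h g \<and> lifts ys g h')"
  by (cases ys) auto

lemma lifts_in: "lifts xs h h' \<Longrightarrow> xs \<noteq> [] \<and> h \<in> V \<and> h' \<in> V \<and> hd xs = f h \<and> last xs = f h' \<and> walk xs"
proof (induction xs h h' rule: lifts.induct)
  case (3 a b xs h h')
  then obtain g where "A h g" "lifts (b # xs) g h'" "f h = a" by auto
  with 3 A_hom show ?case by fastforce
qed auto

lemma lifts_append:
  "lifts (xs @ a # ys) h h' \<longleftrightarrow> (\<exists>g. lifts (xs @ [a]) h g \<and> lifts (a # ys) g h')"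
proof (induction xs arbitrary: h)
  case Nil
  show ?case using lifts_in[of "a # ys" h h'] by (auto simp del: lifts.simps(3) simp: lifts.simps(2))
next
  case (Cons b xs)
  then show ?case by (simp add: lifts_Cons) blast
qed

text \<open>Homotopy lifting, move by move: \<open>A_lift\<close> supplies an inserted vertex,
  \<open>A_tri\<close> closes the triangle upstairs, and \<open>A_inj\<close> collapses a lifted
  stutter.\<close>

lemma lifts_htp: "htp xs ys \<Longrightarrow> lifts xs h h' \<longleftrightarrow> lifts ys h h'"
proof (induction arbitrary: h h' rule: htp.induct)
  case (htp_triangle a b c xs ys)
  have "lifts (a # b # c # ys) g g' \<longleftrightarrow> lifts (a # c # ys) g g'" for g g'
  proof
    assume "lifts (a # b # c # ys) g g'"
    then obtain g1 g2 where g: "f g = a" "A g g1" "f g1 = b" "A g1 g2" "lifts (c # ys) g2 g'"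
      by auto
    then have "f g2 = c" using lifts_in by fastforce
    then have "A g g2" using A_tri[OF A_sym[OF g(2)] g(4)] g htp_triangle by simp
    with g show "lifts (a # c # ys) g g'" by auto
  next
    assume "lifts (a # c # ys) g g'"
    then obtain g2 where g: "f g = a" "A g g2" "lifts (c # ys) g2 g'" by auto
    then have "f g2 = c" using lifts_in by fastforce
    obtain g1 where g1: "A g g1" "f g1 = b" using A_lift[of g b] g A_hom htp_triangle by blast
    then have "A g1 g2" using A_tri[OF g1(1) g(2)] htp_triangle \<open>f g2 = c\<close> by simp
    with g g1 show "lifts (a # b # c # ys) g g'" by auto
  qed
  then show ?case
    using lifts_append[of xs a "b # c # ys"] lifts_append[of xs a "c # ys"] by simp
next
  case (htp_stutter xs a ys)
  have "lifts (a # a # ys) g g' \<longleftrightarrow> lifts (a # ys) g g'" for g g'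
  proof
    assume "lifts (a # a # ys) g g'"
    then obtain g1 where g: "f g = a" "A g g1" "lifts (a # ys) g1 g'" by auto
    then have "f g1 = a" using lifts_in by fastforce
    with A_inj g show "lifts (a # ys) g g'" by metis
  next
    assume "lifts (a # ys) g g'"
    moreover from this have "g \<in> V" "f g = a" using lifts_in by fastforce+
    ultimately show "lifts (a # a # ys) g g'" using A_refl by auto
  qed
  then show ?case
    using lifts_append[of xs a "a # ys"] lifts_append[of xs a "ys"] by simp
qed auto

text \<open>A walk upstairs between two points of one fibre projects to a closed walk. This is
  null-homotopic, and a one-vertex walk lifts only to a single point.\<close>

lemma cover_injective:
  assumes "simply_conn" and conn: "\<And>x y. \<lbrakk>x \<in> V; y \<in> V\<rbrakk> \<Longrightarrow> A\<^sup>*\<^sup>* x y"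
  shows "inj_on f V"
proof
  fix x y assume xy: "x \<in> V" "y \<in> V" "f x = f y"
  have "\<exists>xs. lifts xs x y" using conn[OF xy(1,2)] xy(2)
  proof (induction rule: converse_rtranclp_induct)
    case base
    then have "lifts [f y] y y" by simp
    then show ?case ..
  next
    case (step x z)
    then obtain xs where xs: "lifts xs z y" by blast
    then have "lifts (f x # xs) x y" using step(1) lifts_in[OF xs] by (auto simp: lifts_Cons)
    then show ?case ..
  qed
  then obtain xs where xs: "lifts xs x y" by blast
  then have "htp xs [f x]" using lifts_in[OF xs] xy assms(1) unfolding simply_conn_def by metis
  with xs have "lifts [f x] x y" using lifts_htp by blast
  then show "x = y" by simp
qed

end

section \<open>The universal cover, one sphere at a time\<close>

definition missing :: "('a \<Rightarrow> 'a \<Rightarrow> bool) \<Rightarrow> nat \<Rightarrow> 'a list set \<Rightarrow> ('a list \<Rightarrow> 'a list \<Rightarrow> bool)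
    \<Rightarrow> 'a \<Rightarrow> 'a list \<Rightarrow> bool" where
  "missing E k V A z x \<longleftrightarrow>
     x \<in> V \<and> length x = k \<and> near E (hd x) z \<and> \<not> (\<exists>y. A x y \<and> hd y = z)"

definition same_lift :: "('a \<Rightarrow> 'a \<Rightarrow> bool) \<Rightarrow> nat \<Rightarrow> 'a list set \<Rightarrow> ('a list \<Rightarrow> 'a list \<Rightarrow> bool)
    \<Rightarrow> 'a \<Rightarrow> 'a list \<Rightarrow> 'a list \<Rightarrow> bool" where
  "same_lift E k V A z x y \<longleftrightarrow> missing E k V A z x \<and> missing E k V A z y \<and> A x y"

text \<open>A canonical name for the class of \<open>x\<close>, since the choice depends on the
  class alone. Prefixing \<open>z\<close> keeps all levels in one type and records the image as head
  and the level as length.\<close>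

definition new_vertex :: "('a \<Rightarrow> 'a \<Rightarrow> bool) \<Rightarrow> nat \<Rightarrow> 'a list set \<Rightarrow> ('a list \<Rightarrow> 'a list \<Rightarrow> bool)
    \<Rightarrow> 'a \<Rightarrow> 'a list \<Rightarrow> 'a list" where
  "new_vertex E k V A z x = z # (SOME y. (same_lift E k V A z)\<^sup>*\<^sup>* x y)"

definition next_V :: "('a \<Rightarrow> 'a \<Rightarrow> bool) \<Rightarrow> nat \<Rightarrow> 'a list set \<Rightarrow> ('a list \<Rightarrow> 'a list \<Rightarrow> bool)
    \<Rightarrow> 'a list set" where
  "next_V E k V A = V \<union> {new_vertex E k V A z x | z x. missing E k V A z x}"

text \<open>New vertices are joined to the members of their class, and to each other only above a
  common old vertex; \<open>z = z'\<close> provides the reflexive pairs.\<close>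

definition next_A :: "('a \<Rightarrow> 'a \<Rightarrow> bool) \<Rightarrow> nat \<Rightarrow> 'a list set \<Rightarrow> ('a list \<Rightarrow> 'a list \<Rightarrow> bool)
    \<Rightarrow> 'a list \<Rightarrow> 'a list \<Rightarrow> bool" where
  "next_A E k V A p q \<longleftrightarrow> A p q
     \<or> (\<exists>z. missing E k V A z p \<and> q = new_vertex E k V A z p)
     \<or> (\<exists>z. missing E k V A z q \<and> p = new_vertex E k V A z q)
     \<or> (\<exists>x z z'. missing E k V A z x \<and> missing E k V A z' x \<and> near E z z' \<and>
          p = new_vertex E k V A z x \<and> q = new_vertex E k V A z' x)"

text \<open>The ball of radius \<open>k - 1\<close> of the universal cover. A vertex is a list whose head is its
  image in the graph and whose length is one more than its distance from the root.\<close>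
locale cover_ball = connected_graph E for E :: "'a \<Rightarrow> 'a \<Rightarrow> bool" +
  fixes u :: 'a and k :: nat and V :: "'a list set" and A :: "'a list \<Rightarrow> 'a list \<Rightarrow> bool"
  assumes ch: "clique_Helly E"
    and root: "[u] \<in> V"
    and V_length: "x \<in> V \<Longrightarrow> x \<noteq> [] \<and> length x \<le> k"
    and root_unique: "\<lbrakk>x \<in> V; length x = 1\<rbrakk> \<Longrightarrow> x = [u]"
    and A_hom: "A x y \<Longrightarrow> x \<in> V \<and> y \<in> V \<and> nb (hd x) (hd y) \<and> length y \<le> Suc (length x)"
    and A_refl: "x \<in> V \<Longrightarrow> A x x"
    and A_sym: "A x y \<Longrightarrow> A y x"
    and A_inj: "\<lbrakk>A x y; hd x = hd y\<rbrakk> \<Longrightarrow> x = y"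
    and A_tri: "\<lbrakk>A x y; A x y'; nb (hd y) (hd y')\<rbrakk> \<Longrightarrow> A y y'"
    and A_lift: "\<lbrakk>x \<in> V; length x < k; nb (hd x) z\<rbrakk> \<Longrightarrow> \<exists>y. A x y \<and> hd y = z"
    and A_dom: "\<lbrakk>x \<in> V; x \<noteq> [u]\<rbrakk> \<Longrightarrow> \<exists>w. length x = Suc (length w) \<and>
                  (\<forall>y. A x y \<and> length y \<le> length x \<longrightarrow> A w y)"
begin

abbreviation "miss \<equiv> missing E k V A"
abbreviation "same \<equiv> same_lift E k V A"
abbreviation "new \<equiv> new_vertex E k V A"

lemma missD: "miss z x \<Longrightarrow> x \<in> V \<and> length x = k \<and> nb (hd x) z"
  by (simp add: missing_def)

lemma miss_no_lift: "\<lbrakk>miss z x; A x y\<rbrakk> \<Longrightarrow> hd y \<noteq> z"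
  by (auto simp: missing_def)

text \<open>A lift of \<open>z\<close> at \<open>y\<close> would be adjacent to \<open>x\<close> by
  \<open>A_tri\<close>, and a vertex inside the outermost level has all its lifts. So a class
  absorbs every neighbour of a member whose image is near \<open>z\<close>.\<close>

lemma miss_nb:
  assumes "miss z x" "A x y" "nb (hd y) z"
  shows "miss z y"
proof -
  have no: "\<not> (A y t \<and> hd t = z)" for t
  proof
    assume t: "A y t \<and> hd t = z"
    then have "A x t" using A_tri[of y x t] A_sym[OF assms(2)] missD[OF assms(1)] by auto
    with t assms(1) miss_no_lift show False by blast
  qed
  have "y \<in> V" using A_hom assms(2) by blast
  moreover have "\<not> length y < k" using A_lift[OF \<open>y \<in> V\<close> _ assms(3)] no by blast
  ultimately show ?thesis using V_length[of y] assms(3) no by (auto simp: missing_def)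
qed

lemma same_sym: "same z x y \<Longrightarrow> same z y x"
  using A_sym by (auto simp: same_lift_def)

lemma same_rtranclp_sym: "(same z)\<^sup>*\<^sup>* x y \<Longrightarrow> (same z)\<^sup>*\<^sup>* y x"
  by (metis same_sym symp_rtranclp sympD sympI)

lemma same_rtranclp_miss: "\<lbrakk>(same z)\<^sup>*\<^sup>* x y; miss z x\<rbrakk> \<Longrightarrow> miss z y"
  by (induction rule: rtranclp_induct) (auto simp: same_lift_def)

lemma new_cong: "(same z)\<^sup>*\<^sup>* x y \<Longrightarrow> new z x = new z y"
proof -
  assume xy: "(same z)\<^sup>*\<^sup>* x y"
  have "(same z)\<^sup>*\<^sup>* x t \<longleftrightarrow> (same z)\<^sup>*\<^sup>* y t" for t
    using rtranclp_trans[OF xy] rtranclp_trans[OF same_rtranclp_sym[OF xy]] by blast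
  then have "(same z)\<^sup>*\<^sup>* x = (same z)\<^sup>*\<^sup>* y" by (intro ext)
  then show ?thesis by (simp add: new_vertex_def)
qed

lemma new_eqD: "new z x = new z' y \<Longrightarrow> z = z' \<and> (same z)\<^sup>*\<^sup>* x y"
proof -
  assume eq: "new z x = new z' y"
  have "(same w)\<^sup>*\<^sup>* v (SOME t. (same w)\<^sup>*\<^sup>* v t)" for w v
    by (rule someI[of _ v]) simp
  with eq show ?thesis unfolding new_vertex_def
    by (metis list.inject rtranclp_trans same_rtranclp_sym)
qed

lemma hd_new [simp]: "hd (new z x) = z"
  by (simp add: new_vertex_def)

lemma new_length: "miss z x \<Longrightarrow> length (new z x) = Suc k"
proof -
  assume "miss z x"
  moreover have "(same z)\<^sup>*\<^sup>* x (SOME t. (same z)\<^sup>*\<^sup>* x t)"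
    by (rule someI[of _ x]) simp
  ultimately have "miss z (SOME t. (same z)\<^sup>*\<^sup>* x t)"
    using same_rtranclp_miss by blast
  then show ?thesis using missD by (simp add: new_vertex_def)
qed

lemma new_notin: "miss z x \<Longrightarrow> new z x \<notin> V"
  using new_length V_length by fastforce

lemma new_cong1: "\<lbrakk>miss z x; A x y; nb (hd y) z\<rbrakk> \<Longrightarrow> miss z y \<and> new z x = new z y"
  using miss_nb[of z x y] by (auto intro!: new_cong simp: same_lift_def)

text \<open>All preimages of a new vertex are adjacent to one of them: by Zorn's lemma some preimage
  has a maximal set of common neighbours with \<open>z\<close>, and maximality is contradicted by applying
  the clique-Helly property around the triangle spanned by \<open>z\<close> and two adjacent preimages.\<close>
lemma class_center:
  assumes miss: "miss z x0"
  shows "\<exists>p. (same z)\<^sup>*\<^sup>* x0 p \<and>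
    (\<forall>x. (same z)\<^sup>*\<^sup>* x0 x \<longrightarrow> A p x \<and> (\<forall>t. nb (hd x) t \<and> nb z t \<longrightarrow> nb (hd p) t))"
proof (cases "k = 1")
  case True
  have only: "x = [u]" if "miss z x" for x
    using missD[OF that] root_unique True by auto
  have "x = x0" if "(same z)\<^sup>*\<^sup>* x0 x" for x
    using only[OF miss] only[OF same_rtranclp_miss[OF that miss]] by simp
  then show ?thesis using missD[OF miss] A_refl by (intro exI[of _ x0]) auto
next
  case False
  define P where "P = {x. (same z)\<^sup>*\<^sup>* x0 x}"
  define D where "D x = {t. nb (hd x) t \<and> nb z t}" for x
  define le where "le x y \<longleftrightarrow> A x y \<and> D x \<subseteq> D y" for x y
  have PD: "miss z x" if "x \<in> P" for x
    using same_rtranclp_miss that miss unfolding P_def by blast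
  have PV: "x \<in> V" "length x = k" "nb (hd x) z" if "x \<in> P" for x
    using missD[OF PD[OF that]] by auto
  have P_closed: "y \<in> P" if "x \<in> P" "A x y" "nb (hd y) z" for x y
  proof -
    have "same z x y" using miss_nb[OF PD] PD that by (simp add: same_lift_def)
    with that(1) show ?thesis unfolding P_def by auto
  qed
  have hdD: "hd x \<in> D x" "z \<in> D x" if "x \<in> P" for x
    using PV[OF that] nb_sym unfolding D_def by auto
  \<comment> \<open>Every neighbour of the image of an inner vertex \<open>w\<close> lifts at
    \<open>w\<close>. This is how a vertex of the graph found by the clique-Helly property is
    brought back into the cover.\<close>
  have below: "\<exists>w. (\<forall>y. A p y \<and> length y \<le> k \<longrightarrow> A w y) \<and> w \<in> V \<and> length w < k \<and> \<not> nb (hd w) z"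
    if p: "p \<in> P" for p
  proof -
    have "p \<noteq> [u]" using PV(2)[OF p] False by auto
    then obtain w where w: "length p = Suc (length w)"
      "\<forall>y. A p y \<and> length y \<le> length p \<longrightarrow> A w y"
      using A_dom PV(1)[OF p] by blast
    then have wp: "A w p" using A_refl PV(1)[OF p] by blast
    have "\<not> nb (hd w) z"
    proof
      assume "nb (hd w) z"
      then have "miss z w" by (rule miss_nb[OF PD[OF p] A_sym[OF wp]])
      then show False using missD[of z w] w(1) PV(2)[OF p] by simp
    qed
    moreover have "w \<in> V" using A_hom[OF wp] by blast
    moreover have "length w < k" "length p = k" using w(1) PV(2)[OF p] by auto
    ultimately show ?thesis using w(2) by blast
  qed
  have "\<exists>m\<in>P. \<forall>x\<in>P. le m x \<longrightarrow> le x m"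
  proof (rule preorder_Zorn)
    show "P \<noteq> {}" unfolding P_def by blast
    show "le x x" if "x \<in> P" for x using PV(1)[OF that] A_refl by (simp add: le_def)
    show "le x y'" if xy: "x \<in> P" "y \<in> P" "y' \<in> P" "le x y" "le y y'" for x y y'
    proof -
      have "hd x \<in> D y'" using xy hdD(1)[OF xy(1)] unfolding le_def by blast
      then have "nb (hd x) (hd y')" using nb_sym unfolding D_def by blast
      then show ?thesis using xy A_tri[of y x y'] A_sym unfolding le_def by blast
    qed
    fix C assume CP: "C \<subseteq> P" and "C \<noteq> {}"
      and lin: "\<And>x y. \<lbrakk>x \<in> C; y \<in> C\<rbrakk> \<Longrightarrow> le x y \<or> le y x"
    have CA: "A x y" if "x \<in> C" "y \<in> C" for x y
      using lin[OF that] A_sym unfolding le_def by blast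
    then have Cnb: "nb (hd x) (hd y)" if "x \<in> C" "y \<in> C" for x y
      using A_hom that by blast
    obtain p0 where "p0 \<in> C" using \<open>C \<noteq> {}\<close> by blast
    with below CP obtain w where w: "\<forall>y. A p0 y \<and> length y \<le> k \<longrightarrow> A w y"
      "w \<in> V" "length w < k" "\<not> nb (hd w) z" by blast
    have wC: "A w p" if "p \<in> C" for p
      using w(1) CA[OF \<open>p0 \<in> C\<close> that] PV(2) CP that by auto
    \<comment> \<open>The clique through \<open>hd w\<close> makes \<open>q\<close> lift at
      \<open>w\<close>; the others force \<open>D p \<subseteq> D y\<close> for the lift
      \<open>y\<close>.\<close>
    let ?K1 = "{insert t (hd ` {p\<in>C. t \<in> D p}) | t. t \<in> (\<Union>p\<in>C. D p)}"
    let ?K2 = "{insert (hd w) (hd ` C)}"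
    have "\<exists>q. \<forall>X\<in>?K1 \<union> ?K2. \<forall>x\<in>X. nb q x"
    proof (rule clique_Helly_common[OF ch])
      have ins: "clique E (insert a (hd ` B))" if "B \<subseteq> C" "\<And>p. p \<in> B \<Longrightarrow> nb a (hd p)" for a B
        unfolding clique_insert using that Cnb by (auto simp: clique_near subset_iff)
      fix X assume "X \<in> ?K1 \<union> ?K2"
      then consider t where "X = insert t (hd ` {p\<in>C. t \<in> D p})" | "X = insert (hd w) (hd ` C)"
        by blast
      then show "clique E X"
      proof cases
        case 1
        show ?thesis unfolding 1 by (intro ins) (auto simp: D_def nb_sym)
      next
        case 2
        show ?thesis unfolding 2 by (intro ins) (use wC A_hom in auto)
      qed
    next
      fix X Y assume XY: "X \<in> ?K1 \<union> ?K2" "Y \<in> ?K1 \<union> ?K2"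
      have up: "\<exists>p\<in>C. \<forall>p'\<in>C. le p p' \<longrightarrow> hd p' \<in> Z" if "Z \<in> ?K1 \<union> ?K2" for Z
        using that \<open>C \<noteq> {}\<close> unfolding le_def by blast
      obtain p p' where p: "p \<in> C" "\<forall>y\<in>C. le p y \<longrightarrow> hd y \<in> X" "p' \<in> C" "\<forall>y\<in>C. le p' y \<longrightarrow> hd y \<in> Y"
        using up[OF XY(1)] up[OF XY(2)] by blast
      moreover have "le p p" "le p' p'" using p(1,3) lin by blast+
      ultimately show "X \<inter> Y \<noteq> {}" using lin[of p p'] by blast
    qed
    then obtain q where q: "\<forall>X\<in>?K1 \<union> ?K2. \<forall>x\<in>X. nb q x" ..
    have q1: "nb q t" if "p \<in> C" "t \<in> D p" for p t
      using bspec[OF q, of "insert t (hd ` {p\<in>C. t \<in> D p})"] that by blast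
    have q2: "nb q (hd w)"
      using bspec[OF q, of "insert (hd w) (hd ` C)"] by blast
    obtain y where y: "A w y" "hd y = q" using A_lift[OF w(2,3)] nb_sym[OF q2] by blast
    have py: "A p y" if "p \<in> C" for p
      using A_tri[OF wC[OF that] y(1)] q1[OF that hdD(1)] CP that y(2) nb_sym by blast
    have "nb q z" using q1[OF \<open>p0 \<in> C\<close> hdD(2)] \<open>p0 \<in> C\<close> CP by blast
    then have "y \<in> P" using P_closed[of p0 y] \<open>p0 \<in> C\<close> CP py y(2) by blast
    moreover have "le p y" if "p \<in> C" for p
      unfolding le_def
    proof
      show "D p \<subseteq> D y"
        using q1[OF that] y(2) unfolding D_def by blast
    qed (rule py[OF that])
    ultimately show "\<exists>q\<in>P. \<forall>x\<in>C. le x q" by blast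
  qed
  then obtain p where pP: "p \<in> P" and max: "\<And>x. x \<in> P \<Longrightarrow> le p x \<Longrightarrow> le x p" by blast
  have adj: "D m \<subseteq> D p" if m: "m \<in> P" "A p m" for m
  proof -
    obtain w where w: "\<forall>y. A p y \<and> length y \<le> k \<longrightarrow> A w y" "w \<in> V" "length w < k" "\<not> nb (hd w) z"
      using below[OF pP] by blast
    have wpm: "A w p" "A w m" using w(1) m PV A_refl pP by auto
    \<comment> \<open>The families meet pairwise: \<open>?K1\<close> and \<open>?K2\<close> in
      \<open>z\<close>, \<open>?K1\<close> and \<open>?K3\<close> in \<open>hd p\<close>,
      \<open>?K2\<close> and \<open>?K3\<close> in \<open>hd m\<close>.\<close>
    let ?K1 = "{{t, z, hd p} | t. t \<in> D p}"
    let ?K2 = "{{t, z, hd m} | t. t \<in> D m}"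
    let ?K3 = "{{hd w, hd p, hd m}}"
    have "\<exists>q. \<forall>X\<in>?K1 \<union> ?K2 \<union> ?K3. \<forall>x\<in>X. nb q x"
    proof (rule clique_Helly_common[OF ch])
      have "clique E {t, z, hd x}" if "x \<in> P" "t \<in> D x" for t x
        using that PV(3)[OF that(1)] nb_sym unfolding clique_insert D_def by (auto simp: clique_near)
      moreover have "clique E {hd w, hd p, hd m}"
        using A_hom wpm m(2) unfolding clique_insert by (auto simp: clique_near)
      ultimately show "clique E X" if "X \<in> ?K1 \<union> ?K2 \<union> ?K3" for X
        using that pP m(1) by blast
    qed blast
    then obtain q where q: "\<forall>X\<in>?K1 \<union> ?K2 \<union> ?K3. \<forall>x\<in>X. nb q x" ..
    have q1: "nb q t" if t: "t \<in> D p \<union> D m" for t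
    proof (cases "t \<in> D p")
      case True
      then show ?thesis using bspec[OF q, of "{t, z, hd p}"] by blast
    next
      case False
      then show ?thesis using bspec[OF q, of "{t, z, hd m}"] t by blast
    qed
    have "nb q (hd w)" using bspec[OF q, of "{hd w, hd p, hd m}"] by blast
    then have "nb (hd w) q" by (rule nb_sym)
    then obtain y where y: "A w y" "hd y = q" using A_lift[OF w(2,3)] by blast
    have "nb (hd y) (hd p)" "nb (hd y) z"
      using q1[of "hd p"] q1[of z] hdD[OF pP] y(2) by auto
    then have "nb (hd p) (hd y)" "nb (hd y) z" using nb_sym by auto
    then have "A p y" "y \<in> P" using A_tri[OF wpm(1) y(1)] P_closed[OF pP] by blast+
    moreover have "D p \<union> D m \<subseteq> D y" using q1 y(2) unfolding D_def by blast
    ultimately have "D y \<subseteq> D p" using max[of y] unfolding le_def by blast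
    with \<open>D p \<union> D m \<subseteq> D y\<close> show ?thesis by blast
  qed
  \<comment> \<open>Along a chain of adjacent members, \<open>D x \<subseteq> D p\<close> puts the
    image of the next member \<open>y\<close> near \<open>hd p\<close>. Hence \<open>y\<close> is
    adjacent to \<open>p\<close>, and \<open>adj\<close> applies to it.\<close>
  have all: "A p x \<and> D x \<subseteq> D p" if "(same z)\<^sup>*\<^sup>* x0 x" for x
  proof -
    have "(same z)\<^sup>*\<^sup>* p x"
      using pP that same_rtranclp_sym unfolding P_def by (blast intro: rtranclp_trans)
    then show ?thesis
    proof (induction rule: rtranclp_induct)
      case base
      then show ?case using pP PV A_refl by blast
    next
      case (step x y)
      then have xy: "A x y" "miss z x" "miss z y" by (auto simp: same_lift_def)
      then have "hd y \<in> D x" using A_hom missD nb_sym unfolding D_def by blast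
      then have "nb (hd p) (hd y)" using step.IH unfolding D_def by blast
      then have "A p y" using A_tri[OF A_sym[of p x] xy(1)] step.IH by blast
      moreover have "y \<in> P" using P_closed[OF pP \<open>A p y\<close>] missD[OF xy(3)] by blast
      ultimately show ?case using adj by blast
    qed
  qed
  then show ?thesis using pP unfolding P_def D_def by blast
qed

abbreviation "V' \<equiv> next_V E k V A"
abbreviation "A' \<equiv> next_A E k V A"

lemma next_A_cases:
  assumes "A' p q"
  obtains (old) "A p q"
    | (up) z where "miss z p" "q = new z p"
    | (down) z where "miss z q" "p = new z q"
    | (level) x z z' where "miss z x" "miss z' x" "nb z z'" "p = new z x" "q = new z' x"
  using assms unfolding next_A_def by blast

text \<open>The centre of the class is adjacent to all members, and its image is near every
  neighbour of \<open>z\<close> that is near the image of a member. So it inherits the neighbours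
  below and beside the new vertex.\<close>

lemma new_dominated:
  assumes "miss z x0"
  shows "\<exists>p. miss z p \<and> new z x0 = new z p \<and> (\<forall>q. A' (new z x0) q \<longrightarrow> A' p q)"
proof -
  obtain p where p: "(same z)\<^sup>*\<^sup>* x0 p"
    "\<And>x. (same z)\<^sup>*\<^sup>* x0 x \<Longrightarrow> A p x \<and> (\<forall>t. nb (hd x) t \<and> nb z t \<longrightarrow> nb (hd p) t)"
    using class_center[OF assms] by blast
  have "A' p q" if "A' (new z x0) q" for q
    using that
  proof (cases rule: next_A_cases)
    case old
    then show ?thesis using A_hom new_notin[OF assms] by blast
  next
    case (up z')
    then show ?thesis using missD new_notin[OF assms] by blast
  next
    case (down z')
    then have "(same z)\<^sup>*\<^sup>* x0 q" using new_eqD by blast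
    with p(2) show ?thesis unfolding next_A_def by blast
  next
    case (level x z1 z')
    then have x: "z1 = z" "(same z)\<^sup>*\<^sup>* x0 x" using new_eqD by blast+
    then have "A x p" "nb (hd p) z'" using p(2) missD[OF level(2)] level(3) A_sym by blast+
    then have "miss z' p" "new z' x = new z' p" using new_cong1[OF level(2)] by blast+
    then show ?thesis using level(5) unfolding next_A_def by metis
  qed
  then show ?thesis using p(1) new_cong same_rtranclp_miss[OF p(1) assms] by blast
qed

lemma next_cover_ball: "cover_ball E u (Suc k) V' A'"
proof unfold_locales
  show "clique_Helly E" by (rule ch)
  show "[u] \<in> V'" using root by (simp add: next_V_def)
  show len: "x \<noteq> [] \<and> length x \<le> Suc k" if "x \<in> V'" for x
    using that new_length V_length unfolding next_V_def by (fastforce simp: new_vertex_def)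
  show "x = [u]" if "x \<in> V'" "length x = 1" for x
  proof -
    have "k \<noteq> 0" using V_length[OF root] by auto
    then show ?thesis using that new_length root_unique unfolding next_V_def by auto
  qed
  show A'_sym: "A' y x" if "A' x y" for x y
    using that A_sym nb_sym unfolding next_A_def by metis
  show "A' x x" if "x \<in> V'" for x
    using that A_refl nb_refl unfolding next_V_def next_A_def by blast
  show A'_hom: "x \<in> V' \<and> y \<in> V' \<and> nb (hd x) (hd y) \<and> length y \<le> Suc (length x)" if "A' x y" for x y
    using that
  proof (cases rule: next_A_cases)
    case old
    then show ?thesis using A_hom unfolding next_V_def by blast
  next
    case (up z)
    then show ?thesis using missD[OF up(1)] new_length[OF up(1)] unfolding next_V_def by auto
  next
    case (down z)
    then show ?thesis using missD[OF down(1)] new_length[OF down(1)] nb_sym unfolding next_V_def by auto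
  next
    case (level x z z')
    then show ?thesis using new_length unfolding next_V_def by auto
  qed
  have A'_old: "A x y" if "A' x y" "x \<in> V" "y \<in> V" for x y
    using that(1) by (cases rule: next_A_cases) (use that new_notin in auto)
  have A'_up: "\<exists>z. miss z x \<and> y = new z x" if "A' x y" "x \<in> V" "y \<notin> V" for x y
    using that(1)
  proof (cases rule: next_A_cases)
    case old
    then show ?thesis using A_hom that by blast
  next
    case (down z)
    then show ?thesis using new_notin that by blast
  next
    case (level x' z z')
    then show ?thesis using new_notin that by blast
  qed blast
  show "x = y" if xy: "A' x y" "hd x = hd y" for x y
    using xy(1)
  proof (cases rule: next_A_cases)
    case old
    then show ?thesis using A_inj xy(2) by blast
  next
    case (up z)
    then show ?thesis using miss_no_lift[OF up(1) A_refl] missD[OF up(1)] xy(2) by auto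
  next
    case (down z)
    then show ?thesis using miss_no_lift[OF down(1) A_refl] missD[OF down(1)] xy(2) by auto
  next
    case (level x' z z')
    then show ?thesis using xy(2) by simp
  qed
  have tri: "A' y y'" if h: "x \<in> V" "A' x y" "A' x y'" "nb (hd y) (hd y')" for x y y'
  proof -
    have mixed: "A' s t" if st: "A' x s" "A' x t" "nb (hd s) (hd t)" "s \<in> V" "t \<notin> V" for s t
    proof -
      obtain z where z: "miss z x" "t = new z x" using A'_up[OF st(2) h(1) st(5)] by blast
      have "A x s" using A'_old st h(1) by blast
      with new_cong1[OF z(1)] st(3) z(2) have "miss z s" "t = new z s" by auto
      then show ?thesis unfolding next_A_def by blast
    qed
    consider "y \<in> V" "y' \<in> V" | "y \<in> V" "y' \<notin> V" | "y \<notin> V" "y' \<in> V" | "y \<notin> V" "y' \<notin> V" by blast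
    then show ?thesis
    proof cases
      case 1
      then have "A y y'" using A'_old h A_tri by blast
      then show ?thesis unfolding next_A_def by blast
    next
      case 2
      then show ?thesis using mixed h by blast
    next
      case 3
      then show ?thesis using mixed[of y' y] h nb_sym A'_sym by blast
    next
      case 4
      then obtain z z' where "miss z x" "y = new z x" "miss z' x" "y' = new z' x"
        using A'_up h by blast
      then show ?thesis using h(4) unfolding next_A_def by fastforce
    qed
  qed
  show "A' y y'" if h: "A' x y" "A' x y'" "nb (hd y) (hd y')" for x y y'
  proof (cases "x \<in> V")
    case True
    then show ?thesis using tri h by blast
  next
    case False
    then obtain z x0 where x: "x = new z x0" "miss z x0"
      using A'_hom[OF h(1)] unfolding next_V_def by blast
    \<comment> \<open>All neighbours of the new vertex are neighbours of the old vertex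
      \<open>p\<close>, where \<open>tri\<close> applies.\<close>
    then obtain p where "miss z p" "\<And>q. A' x q \<Longrightarrow> A' p q" using new_dominated by blast
    then show ?thesis using tri[of p] missD h by blast
  qed
  show "\<exists>y. A' x y \<and> hd y = z" if h: "x \<in> V'" "length x < Suc k" "nb (hd x) z" for x z
  proof -
    have "x \<in> V" using h(1,2) new_length unfolding next_V_def by fastforce
    show ?thesis
    proof (cases "miss z x")
      case True
      then have "A' x (new z x)" unfolding next_A_def by blast
      then show ?thesis using hd_new by blast
    next
      case False
      have "\<exists>y. A x y \<and> hd y = z"
        using False A_lift[OF \<open>x \<in> V\<close> _ h(3)] h \<open>x \<in> V\<close> unfolding missing_def by fastforce
      then show ?thesis unfolding next_A_def by blast
    qed
  qed
  show "\<exists>w. length x = Suc (length w) \<and> (\<forall>y. A' x y \<and> length y \<le> length x \<longrightarrow> A' w y)"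
    if x: "x \<in> V'" "x \<noteq> [u]" for x
  proof (cases "x \<in> V")
    case True
    then obtain w where w: "length x = Suc (length w)" "\<forall>y. A x y \<and> length y \<le> length x \<longrightarrow> A w y"
      using A_dom x(2) by blast
    have "A' w y" if y: "A' x y" "length y \<le> length x" for y
    proof -
      have "y \<in> V'" using A'_hom y(1) by blast
      then have "y \<in> V" using y(2) V_length[OF True] new_length unfolding next_V_def by fastforce
      with A'_old y True w(2) show ?thesis unfolding next_A_def by blast
    qed
    with w(1) show ?thesis by blast
  next
    case False
    then obtain z x0 where x: "x = new z x0" "miss z x0"
      using x(1) unfolding next_V_def by blast
    then obtain p where "miss z p" "\<And>q. A' x q \<Longrightarrow> A' p q" using new_dominated by blast
    then show ?thesis using missD new_length[OF x(2)] x(1) by (intro exI[of _ p]) auto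
  qed
qed

lemma next_A_length: "\<lbrakk>A' x y; length x \<le> k; length y \<le> k\<rbrakk> \<Longrightarrow> A x y"
  by (erule next_A_cases) (auto simp: new_length)

end

section \<open>The union of the stages and its identification with the graph\<close>

text \<open>Stage \<open>k\<close> is the ball of radius \<open>k\<close>; its lists have length up
  to \<open>Suc k\<close>, which is therefore the parameter of \<open>cover_ball\<close>.\<close>

primrec cover_stage :: "('a \<Rightarrow> 'a \<Rightarrow> bool) \<Rightarrow> 'a \<Rightarrow> nat \<Rightarrow> 'a list set \<times> ('a list \<Rightarrow> 'a list \<Rightarrow> bool)" where
  "cover_stage E u 0 = ({[u]}, \<lambda>x y. x = [u] \<and> y = [u])"
| "cover_stage E u (Suc k) =
     (next_V E (Suc k) (fst (cover_stage E u k)) (snd (cover_stage E u k)),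
      next_A E (Suc k) (fst (cover_stage E u k)) (snd (cover_stage E u k)))"

context connected_graph
begin

theorem BFS_dominated_if_simply_conn:
  assumes ch: "clique_Helly E" and sc: "simply_conn"
  shows "BFS_dominated E u"
proof -
  define VV where "VV k = fst (cover_stage E u k)" for k
  define AA where "AA k = snd (cover_stage E u k)" for k
  have stage: "cover_ball E u (Suc k) (VV k) (AA k)" for k
  proof (induction k)
    case 0
    show ?case
      by unfold_locales (use ch in \<open>auto simp: VV_def AA_def\<close>)
  next
    case (Suc k)
    then show ?case using cover_ball.next_cover_ball by (fastforce simp: VV_def AA_def)
  qed
  note [simp del] = cover_stage.simps
  have VV_Suc: "VV k \<subseteq> VV (Suc k)" for k
    unfolding VV_def cover_stage.simps by (auto simp: next_V_def)
  have AA_Suc: "AA k x y \<Longrightarrow> AA (Suc k) x y" for k x y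
    unfolding AA_def cover_stage.simps by (auto simp: next_A_def)
  have VV_mono: "x \<in> VV k \<Longrightarrow> k \<le> m \<Longrightarrow> x \<in> VV m" for x k m
    using lift_Suc_mono_le[of VV, OF VV_Suc] by blast
  have AA_mono: "k \<le> m \<Longrightarrow> AA k x y \<Longrightarrow> AA m x y" for k m x y
    by (induction rule: dec_induct) (auto intro: AA_Suc)
  \<comment> \<open>Later stages add no adjacency among vertices of lower level, so domination found
    at one stage survives in the union.\<close>
  have AA_down: "AA m x y \<Longrightarrow> k \<le> m \<Longrightarrow> length x \<le> Suc k \<Longrightarrow> length y \<le> Suc k \<Longrightarrow> AA k x y" for k m x y
  proof (induction m)
    case (Suc m)
    show ?case
    proof (cases "k = Suc m")
      case False
      then have "k \<le> m" using Suc.prems by simp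
      have "AA m x y"
        using cover_ball.next_A_length[OF stage, of m x y] Suc.prems \<open>k \<le> m\<close>
        unfolding AA_def VV_def cover_stage.simps by simp
      then show ?thesis using Suc \<open>k \<le> m\<close> by blast
    qed (use Suc in simp)
  qed simp
  define V where "V = (\<Union>k. VV k)"
  define A where "A x y \<longleftrightarrow> (\<exists>k. AA k x y)" for x y
  have A2: "\<exists>k. AA k x y \<and> AA k x' y'" if "A x y" "A x' y'" for x y x' y'
    using that AA_mono unfolding A_def by (meson max.cobounded1 max.cobounded2)
  have A_length: "length y \<le> Suc (length x)" if "A x y" for x y
    using that cover_ball.A_hom[OF stage] unfolding A_def by blast
  interpret C: triangle_cover E V A hd
  proof unfold_locales
    show "x \<in> V \<and> y \<in> V \<and> nb (hd x) (hd y)" if "A x y" for x y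
      using that cover_ball.A_hom[OF stage] unfolding A_def V_def by blast
    show "A x x" if "x \<in> V" for x
      using that cover_ball.A_refl[OF stage] unfolding A_def V_def by blast
    show "A y x" if "A x y" for x y
      using that cover_ball.A_sym[OF stage] unfolding A_def by blast
    show "x = y" if "A x y" "hd x = hd y" for x y
      using that cover_ball.A_inj[OF stage] unfolding A_def by blast
    show "A y y'" if "A x y" "A x y'" "nb (hd y) (hd y')" for x y y'
      using A2[OF that(1,2)] that(3) cover_ball.A_tri[OF stage] unfolding A_def by blast
    show "\<exists>y. A x y \<and> hd y = z" if x: "x \<in> V" "nb (hd x) z" for x z
    proof -
      obtain k where "x \<in> VV k" using x(1) unfolding V_def by blast
      then have "x \<in> VV (Suc k)" "length x < Suc (Suc k)"
        using VV_Suc cover_ball.V_length[OF stage] by fastforce+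
      from cover_ball.A_lift[OF stage this x(2)] show ?thesis unfolding A_def by blast
    qed
  qed
  have root: "[u] \<in> V" using cover_ball.root[OF stage] unfolding V_def by blast
  have dom: "\<exists>w. A w x \<and> length x = Suc (length w) \<and> (\<forall>y. A x y \<and> length y \<le> length x \<longrightarrow> A w y)"
    if x: "x \<in> V" "x \<noteq> [u]" for x
  proof -
    obtain m where m: "x \<in> VV m" using x(1) unfolding V_def by blast
    then have xne: "x \<noteq> []" "AA m x x"
      using cover_ball.V_length[OF stage] cover_ball.A_refl[OF stage] by blast+
    obtain w where w: "length x = Suc (length w)" "\<forall>y. AA m x y \<and> length y \<le> length x \<longrightarrow> AA m w y"
      using cover_ball.A_dom[OF stage m x(2)] by blast
    have "length x \<le> Suc m" using cover_ball.V_length[OF stage m] by blast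
    have "A w y" if y: "A x y" "length y \<le> length x" for y
    proof -
      obtain n where "AA n x y" using y(1) unfolding A_def by blast
      then have "AA (max m n) x y" using AA_mono by (meson max.cobounded2)
      then have "AA m x y" using AA_down[of "max m n" x y m] y(2) \<open>length x \<le> Suc m\<close> by simp
      with w(2) y(2) show ?thesis unfolding A_def by blast
    qed
    with w xne show ?thesis unfolding A_def by blast
  qed
  have Vne: "x \<noteq> []" if "x \<in> V" for x
    using that cover_ball.V_length[OF stage] unfolding V_def by blast
  have to_root: "A\<^sup>*\<^sup>* x [u] \<and> d u (hd x) < length x" if "x \<in> V" for x
    using that
  proof (induction "length x" arbitrary: x rule: less_induct)
    case less
    show ?case
    proof (cases "x = [u]")
      case False
      then obtain w where w: "A w x" "length x = Suc (length w)" using dom less.prems by blast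
      then have "A\<^sup>*\<^sup>* w [u] \<and> d u (hd w) < length w" using less C.A_hom by fastforce
      moreover have "d u (hd x) \<le> Suc (d u (hd w))" using C.A_hom[OF w(1)] nb_gdist by blast
      ultimately show ?thesis
        using C.A_sym[OF w(1)] w(2) by (auto intro: converse_rtranclp_into_rtranclp)
    qed simp
  qed
  have Asym: "A\<^sup>*\<^sup>* y x" if "A\<^sup>*\<^sup>* x y" for x y
    using that by (metis C.A_sym symp_rtranclp sympD sympI)
  have inj: "inj_on hd V"
    by (rule C.cover_injective[OF sc]) (use to_root Asym in \<open>blast intro: rtranclp_trans\<close>)
  have surj: "\<exists>x\<in>V. hd x = v \<and> length x \<le> Suc (d u v)" for v
  proof (induction "d u v" arbitrary: v)
    case 0
    then show ?case using root by force
  next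
    case (Suc n)
    then obtain v' where v': "d u v' \<le> n" "nb v' v" using gdist_Suc_nb[of u v n] by auto
    moreover have "d u v \<le> Suc (d u v')" using nb_gdist[OF v'(2)] .
    ultimately have "n = d u v'" using Suc(2) by simp
    from Suc(1)[OF this] obtain x where x: "x \<in> V" "hd x = v'" "length x \<le> Suc n"
      using \<open>n = d u v'\<close> by blast
    then obtain y where y: "A x y" "hd y = v" using C.A_lift v'(2) by blast
    then show ?case using C.A_hom[OF y(1)] A_length[OF y(1)] x(3) Suc(2) by (intro bexI[of _ y]) auto
  qed
  \<comment> \<open>Injectivity identifies \<open>x\<close> with the short lift from
    \<open>surj\<close>. So length measures distance in the graph, and domination upstairs becomes
    domination in the graph.\<close>
  have len: "length x = Suc (d u (hd x))" if "x \<in> V" for x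
  proof -
    obtain y where "y \<in> V" "hd y = hd x" "length y \<le> Suc (d u (hd x))" using surj by blast
    then show ?thesis using inj to_root[OF that] that by (metis Suc_leI inj_onD le_antisym)
  qed
  have nbA: "A x y" if "x \<in> V" "y \<in> V" "nb (hd x) (hd y)" for x y
    using C.A_lift[OF that(1,3)] C.A_hom inj that(2) by (metis inj_onD)
  show ?thesis
    unfolding BFS_dominated_def
  proof (intro allI impI)
    fix v assume "v \<noteq> u"
    obtain x where x: "x \<in> V" "hd x = v" using surj by blast
    with \<open>v \<noteq> u\<close> have "x \<noteq> [u]" by auto
    then obtain w where w: "A w x" "length x = Suc (length w)"
      "\<forall>y. A x y \<and> length y \<le> length x \<longrightarrow> A w y" using dom x(1) by blast
    then have "w \<in> V" using C.A_hom by blast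
    have "nb (hd w) t" if t: "nb v t" "d u t \<le> d u v" for t
    proof -
      obtain y where y: "y \<in> V" "hd y = t" using surj by blast
      then have "A w y" using w(3) nbA[OF x(1) y(1)] len x y t by simp
      then show ?thesis using C.A_hom y by blast
    qed
    moreover have "d u v = Suc (d u (hd w))" using w(2) len[OF x(1)] len[OF \<open>w \<in> V\<close>] x(2) by simp
    ultimately show "\<exists>w. d u v = Suc (d u w) \<and> (\<forall>x. nb v x \<and> d u x \<le> d u v \<longrightarrow> nb w x)" by blast
  qed
qed


section \<open>Combinatorial simple connectivity\<close>

text \<open>A ladder with rungs from \<open>a i\<close> to \<open>b i\<close>, triangulated by the
  diagonals from \<open>b i\<close> to \<open>a (Suc i)\<close>. The last rung is pushed forward
  across two triangles at each step.\<close>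

lemma htp_parallel:
  assumes "\<And>i. i < N \<Longrightarrow> nb (a i) (a (Suc i))" "\<And>i. i < N \<Longrightarrow> nb (b i) (b (Suc i))"
    and "\<And>i. i < N \<Longrightarrow> nb (b i) (a (Suc i))" "\<And>i. i \<le> N \<Longrightarrow> nb (a i) (b i)"
  shows "htp (map a [0..<Suc N]) (a 0 # map b [0..<Suc N] @ [a N])"
  using assms
proof (induction N)
  case 0
  then show ?case using htp_backtrack[of "a 0" "b 0"] htp_sym by simp
next
  case (Suc N)
  let ?b = "map b [0..<N]"
  have "htp (map a [0..<Suc N]) (a 0 # map b [0..<Suc N] @ [a N])"
    by (rule Suc.IH) (use Suc.prems in auto)
  then have "htp (map a [0..<Suc (Suc N)]) ((a 0 # ?b) @ [b N, a N] @ [a (Suc N)])"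
    using htp_append_right[of _ _ "[a (Suc N)]"] by fastforce
  also have "htp \<dots> ((a 0 # ?b) @ [b N, a (Suc N)] @ [])"
    using htp_triangle[of "b N" "a N" "a (Suc N)" "a 0 # ?b" "[]"]
      Suc.prems(1)[of N] Suc.prems(3)[of N] nb_sym[OF Suc.prems(4)[of N]] by simp
  also have "htp \<dots> ((a 0 # ?b) @ [b N, b (Suc N), a (Suc N)] @ [])"
    using htp_sym[OF htp_triangle[of "b N" "b (Suc N)" "a (Suc N)" "a 0 # ?b" "[]"]]
      Suc.prems(2)[of N] Suc.prems(3)[of N] nb_sym[OF Suc.prems(4)[of "Suc N"]] by simp
  finally show ?case by simp
qed

lemma htp_null_parallel:
  assumes "\<And>i. i < N \<Longrightarrow> nb (a i) (a (Suc i))" "\<And>i. i < N \<Longrightarrow> nb (b i) (b (Suc i))"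
    and "\<And>i. i < N \<Longrightarrow> nb (b i) (a (Suc i))" "\<And>i. i \<le> N \<Longrightarrow> nb (a i) (b i)"
    and "a N = a 0" and "htp (map b [0..<Suc N]) [b 0]"
  shows "htp (map a [0..<Suc N]) [a 0]"
proof -
  have "htp (map a [0..<Suc N]) ([a 0] @ map b [0..<Suc N] @ [a 0])"
    using htp_parallel[of N a b, OF assms(1-4)] assms(5) by simp
  also have "htp \<dots> ([a 0] @ [b 0] @ [a 0])" by (rule htp_append[OF assms(6)])
  also have "htp \<dots> [a 0]" using htp_backtrack[of "a 0" "b 0"] assms(4)[of 0] by simp
  finally show ?thesis .
qed

lemma htp_replicate: "htp (replicate (Suc n) x) [x]"
proof (induction n)
  case (Suc n)
  have "htp ([] @ [x, x] @ replicate n x) ([] @ [x] @ replicate n x)" by (rule htp_stutter)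
  with Suc show ?case by (auto intro: htp_trans)
qed simp

text \<open>Well-founded induction on an upper bound \<open>v\<close> of a closed walk. Replacing
  \<open>v\<close> by its dominator gives a parallel walk, which is finite and avoids
  \<open>v\<close>, so its maximum lies strictly below \<open>v\<close>.\<close>

lemma simply_conn_if_dismantlable:
  assumes "dismantlable E"
  shows simply_conn
proof -
  obtain r where R: "Well_order r \<and> Field r = UNIV \<and> (\<forall>v. (\<exists>u. (u, v) \<in> r \<and> u \<noteq> v) \<longrightarrow>
         (\<exists>w. (w, v) \<in> r \<and> w \<noteq> v \<and> E w v \<and>
            (\<forall>x. (x, v) \<in> r \<and> (x = v \<or> E x v) \<longrightarrow> x = w \<or> E x w)))"
    using assms unfolding dismantlable_def ..
  have r: "Well_order r" "Field r = UNIV" using R by blast+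
  have dom: "\<exists>w. (w, v) \<in> r \<and> w \<noteq> v \<and> E w v \<and>
            (\<forall>x. (x, v) \<in> r \<and> (x = v \<or> E x v) \<longrightarrow> x = w \<or> E x w)"
    if "(u, v) \<in> r" "u \<noteq> v" for u v
    using R that by metis
  have wf: "wf (r - Id)" using r(1) unfolding well_order_on_def by blast
  have lin_r: "Linear_order r" using r(1) unfolding well_order_on_def by blast
  have "(x, x) \<in> r" for x
    using lin_r r(2) unfolding order_on_defs refl_on_def by simp
  moreover have "x \<noteq> y \<longrightarrow> (x, y) \<in> r \<or> (y, x) \<in> r" for x y
    using lin_r r(2) unfolding order_on_defs total_on_def by simp
  ultimately have lin: "(x, y) \<in> r \<or> (y, x) \<in> r" for x y by metis
  have "trans r" using lin_r unfolding order_on_defs by blast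
  then have trans: "(x, z) \<in> r" if "(x, y) \<in> r" "(y, z) \<in> r" for x y z
    using that by (rule transD)
  have max: "\<exists>m\<in>S. \<forall>x\<in>S. (x, m) \<in> r" if "finite S" "S \<noteq> {}" for S
    using that
  proof (induction rule: finite_ne_induct)
    case (singleton x)
    then show ?case using lin[of x x] by simp
  next
    case (insert y S)
    then obtain m where "m \<in> S" "\<forall>x\<in>S. (x, m) \<in> r" by blast
    then show ?case using lin[of m y] lin[of y y] trans by (cases "(m, y) \<in> r") blast+
  qed
  have null: "\<forall>xs. xs \<noteq> [] \<and> walk xs \<and> last xs = hd xs \<and> (\<forall>x\<in>set xs. (x, v) \<in> r) \<longrightarrow> htp xs [hd xs]"
    for v
    using wf
  proof (induction v rule: wf_induct_rule)
    case (less v)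
    show ?case
    proof (intro allI impI)
      fix xs assume xs: "xs \<noteq> [] \<and> walk xs \<and> last xs = hd xs \<and> (\<forall>x\<in>set xs. (x, v) \<in> r)"
      show "htp xs [hd xs]"
      proof (cases "\<exists>u. (u, v) \<in> r \<and> u \<noteq> v")
        case False
        then have "\<forall>x\<in>set xs. x = v" using xs by blast
        then have "xs = replicate (length xs) v" by (simp add: replicate_length_same)
        with xs obtain n where "xs = replicate (Suc n) v" by (metis length_0_conv not0_implies_Suc)
        then show ?thesis using htp_replicate[of n v] by simp
      next
        case True
        then obtain w where w: "(w, v) \<in> r" "w \<noteq> v"
          "\<And>x. (x, v) \<in> r \<Longrightarrow> nb x v \<Longrightarrow> nb x w"
          using dom unfolding near_def by (metis sym)
        define \<rho> where "\<rho> x = (if x = v then w else x)" for x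
        have \<rho>_r: "(\<rho> x, v) \<in> r" "\<rho> x \<noteq> v" if "(x, v) \<in> r" for x
          using that w by (auto simp: \<rho>_def)
        have \<rho>1: "nb x (\<rho> y)" if "nb x y" "(x, v) \<in> r" for x y
          using that w(3) by (auto simp: \<rho>_def)
        have \<rho>2: "nb (\<rho> x) (\<rho> y)" if "nb x y" "(x, v) \<in> r" "(y, v) \<in> r" for x y
          using \<rho>1[of "\<rho> y" x] \<rho>1[OF that(1,2)] nb_sym \<rho>_r(1)[OF that(3)] by blast
        have \<rho>3: "nb (\<rho> x) y" if "nb x y" "(y, v) \<in> r" for x y
          using \<rho>1[of y x] nb_sym that by blast
        define N where "N = length xs - 1"
        have N: "length xs = Suc N" using xs by (simp add: N_def)
        have xsN: "map ((!) xs) [0..<Suc N] = xs" unfolding N[symmetric] by (rule map_nth)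
        have step: "nb (xs ! i) (xs ! Suc i)" if "i < N" for i
          using xs that N by (simp add: successively_conv_nth)
        have below: "(xs ! i, v) \<in> r" if "i \<le> N" for i using xs that N by simp
        let ?b = "\<lambda>i. \<rho> (xs ! i)"
        have ends: "xs ! N = xs ! 0" using xs N last_conv_nth[of xs] hd_conv_nth[of xs] by simp
        let ?ys = "map ?b [0..<Suc N]"
        obtain m where m: "m \<in> set ?ys" "\<forall>x\<in>set ?ys. (x, m) \<in> r"
          using max[of "set ?ys"] by auto
        obtain i where "i \<le> N" "m = \<rho> (xs ! i)"
          using m(1) by (auto simp: less_Suc_eq_le simp del: upt_Suc)
        then have "(m, v) \<in> r - Id" using \<rho>_r[OF below] by blast
        have "htp ?ys [hd ?ys]"
        proof (rule less(1)[OF \<open>(m, v) \<in> r - Id\<close>, rule_format], intro conjI)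
          show "walk ?ys" using step below \<rho>2 by (simp add: successively_conv_nth del: upt_Suc)
          show "last ?ys = hd ?ys" using ends by (simp add: hd_map del: upt_Suc) (simp add: last_map)
        qed (use m(2) in auto)
        then have "htp ?ys [?b 0]" by (simp add: hd_map del: upt_Suc)
        then have "htp (map ((!) xs) [0..<Suc N]) [xs ! 0]"
          by (intro htp_null_parallel[of N "(!) xs" ?b]) (use step below \<rho>1 \<rho>2 \<rho>3 ends in auto)
        then show ?thesis using xsN xs by (simp add: hd_conv_nth)
      qed
    qed
  qed
  show ?thesis
    unfolding simply_conn_def
  proof (intro allI impI)
    fix xs assume xs: "xs \<noteq> [] \<and> walk xs \<and> last xs = hd xs"
    then obtain m where "\<forall>x\<in>set xs. (x, m) \<in> r" using max[of "set xs"] by auto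
    then show "htp xs [hd xs]" using null xs by blast
  qed
qed

section \<open>Closed walks in weakly modular graphs\<close>

text \<open>Both sides of the square are pushed to the path \<open>t\<close>, \<open>c\<close>,
  \<open>v\<close> through its centre.\<close>

lemma htp_square:
  assumes "nb c t" "nb c x" "nb c y" "nb c v" "nb t x" "nb x v" "nb t y" "nb y v"
  shows "htp (zs @ [t, x, v]) (zs @ [t, y, v])"
proof -
  have half: "htp (zs @ [t, w, v]) (zs @ [t, c, v])" if "nb c w" "nb t w" "nb w v" for w
  proof -
    have "htp (zs @ [t, w] @ [v]) (zs @ [t, c, w] @ [v])"
      using htp_triangle[of t c w zs "[v]"] assms(1) that by (auto intro: htp_sym nb_sym)
    also have "htp \<dots> ((zs @ [t]) @ [c, v] @ [])"
      using htp_triangle[of c w v "zs @ [t]" "[]"] assms(4) that by simp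
    finally show ?thesis by simp
  qed
  show ?thesis using half[of x] half[of y] assms by (blast intro: htp_trans htp_sym)
qed

inductive geodesic :: "'a \<Rightarrow> 'a list \<Rightarrow> bool" for u where
  geodesic_start: "geodesic u [u]"
| geodesic_step: "\<lbrakk>geodesic u xs; nb (last xs) v; d u v = Suc (d u (last xs))\<rbrakk> \<Longrightarrow> geodesic u (xs @ [v])"

lemma geodesic_nonempty: "geodesic u xs \<Longrightarrow> xs \<noteq> []"
  by (induction rule: geodesic.induct) auto

lemma geodesic_exists: "\<exists>xs. geodesic u xs \<and> last xs = v"
proof (induction "d u v" arbitrary: v)
  case 0
  then show ?case using geodesic_start by fastforce
next
  case (Suc n)
  then obtain w where w: "d u w \<le> n" "nb w v" using gdist_Suc_nb[of u v n] by auto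
  with nb_gdist[OF w(2), of u] Suc(2) have "d u w = n" by simp
  with Suc(1) obtain xs where "geodesic u xs" "last xs = w" by blast
  with w(2) Suc(2) \<open>d u w = n\<close> geodesic_step[of u xs v] show ?case by fastforce
qed

text \<open>Two geodesics from \<open>u\<close> with the same end are homotopic, and every walk is
  homotopic to a geodesic; for a closed walk that geodesic is trivial. The 1-Helly property fills
  the squares that arise.\<close>

lemma simply_conn_if_weakly_modular:
  assumes wm: "weakly_modular E" and oh: "one_Helly E"
  shows simply_conn
proof -
  \<comment> \<open>The conditions in \<open>weakly_modular\<close> begin at distance 2; at distance
    1 the vertex \<open>u\<close> itself is the common neighbour. The same holds for
    \<open>QC\<close> below.\<close>
  have TC: "\<exists>t. nb t x \<and> nb t y \<and> d u t = k" if xy: "nb x y" "x \<noteq> y" "d u x = Suc k" "d u y = Suc k" for u x y k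
  proof (cases "k = 0")
    case True
    then show ?thesis using xy gdist_le_1[of u x] gdist_le_1[of u y] by (intro exI[of _ u]) auto
  next
    case False
    then obtain t where "E t x" "E t y" "d u t = d u x - 1"
      using wm xy unfolding weakly_modular_def near_def by (metis One_nat_def Suc_less_eq neq0_conv)
    then show ?thesis using xy by (intro exI[of _ t]) (simp add: near_def)
  qed
  have QC: "\<exists>t. nb t x \<and> nb t y \<and> d u t = k"
    if xy: "nb x v" "nb y v" "\<not> nb x y" "d u x = Suc k" "d u y = Suc k" "d u v = Suc (Suc k)" for u x y v k
  proof (cases "k = 0")
    case True
    then show ?thesis using xy gdist_le_1[of u x] gdist_le_1[of u y] by (intro exI[of _ u]) auto
  next
    case False
    have "E x v" "E y v" using xy by (auto simp: near_def)
    have "d x y \<le> Suc (d x v)" "d x v \<le> 1" "\<not> d x y \<le> 1"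
      using nb_gdist[of v y x] xy nb_sym unfolding gdist_le_1 by blast+
    then have "d x y = 2" by simp
    then obtain t where "E t x" "E t y" "d u t = d u x - 1"
      using wm[unfolded weakly_modular_def, THEN conjunct2, rule_format, of x v y u]
        \<open>E x v\<close> \<open>E y v\<close> xy False by auto
    then show ?thesis using xy by (intro exI[of _ t]) (simp add: near_def)
  qed
  \<comment> \<open>The unit balls meet pairwise: those of \<open>t\<close> and \<open>v\<close> in
    \<open>x\<close>, those of \<open>x\<close> and \<open>y\<close> in \<open>t\<close>, and the
    other pairs of centres are near each other.\<close>
  have fill: "\<exists>c. nb c t \<and> nb c x \<and> nb c y \<and> nb c v"
    if sq: "nb t x" "nb x v" "nb t y" "nb y v" for t x y v
  proof -
    let ?S = "{gball E 1 t, gball E 1 x, gball E 1 y, gball E 1 v}"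
    have mem: "t \<in> gball E 1 x" "t \<in> gball E 1 y" "x \<in> gball E 1 t" "y \<in> gball E 1 t"
      "v \<in> gball E 1 x" "v \<in> gball E 1 y" "x \<in> gball E 1 v" "y \<in> gball E 1 v" "t \<in> gball E 1 t"
      "x \<in> gball E 1 x" "y \<in> gball E 1 y" "v \<in> gball E 1 v"
      unfolding gball_1 using sq nb_sym by auto
    then have "\<forall>A\<in>?S. \<forall>B\<in>?S. A \<inter> B \<noteq> {}" by blast
    moreover have "?S \<subseteq> {gball E 1 v | v. True}" by blast
    ultimately have "\<Inter>?S \<noteq> {}" using oh unfolding one_Helly_def Helly_family_def by blast
    then obtain c where "c \<in> gball E 1 t" "c \<in> gball E 1 x" "c \<in> gball E 1 y" "c \<in> gball E 1 v" by auto
    then show ?thesis unfolding gball_1 using nb_sym by blast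
  qed
  have uniq: "htp xs ys" if "geodesic u xs" "geodesic u ys" "last xs = last ys" for u xs ys
    using that
  proof (induction "d u (last xs)" arbitrary: xs ys)
    case 0
    then have "xs = [u]" "ys = [u]" by (auto elim: geodesic.cases)
    then show ?case by simp
  next
    case (Suc n)
    define v where "v = last xs"
    have last: "\<exists>zs'. zs = zs' @ [v] \<and> geodesic u zs' \<and> nb (last zs') v \<and> d u (last zs') = n"
      if "geodesic u zs" "last zs = v" for zs
      using that(1) by (cases rule: geodesic.cases) (use that Suc(2) v_def in auto)
    obtain xs' where xs': "xs = xs' @ [v]" "geodesic u xs'" "nb (last xs') v" "d u (last xs') = n"
      using last[of xs] Suc v_def by blast
    obtain ys' where ys': "ys = ys' @ [v]" "geodesic u ys'" "nb (last ys') v" "d u (last ys') = n"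
      using last[of ys] Suc v_def by metis
    define x where "x = last xs'"
    define y where "y = last ys'"
    have IH: "htp zs zs'" if "geodesic u zs" "geodesic u zs'" "last zs = last zs'" "d u (last zs) = n" for zs zs'
      using Suc(1) that by blast
    show ?case
    proof (cases "x = y")
      case True
      then have "htp xs' ys'" using IH xs' ys' unfolding x_def y_def by blast
      then show ?thesis using htp_append_right xs'(1) ys'(1) by blast
    next
      case False
      then have "n \<noteq> 0" using xs'(4) ys'(4) unfolding x_def y_def by (metis gdist_eq_0)
      then obtain k where k: "n = Suc k" using not0_implies_Suc by blast
      have "\<exists>t. nb t x \<and> nb t y \<and> d u t = k"
      proof (cases "nb x y")
        case True
        then show ?thesis using TC[OF True False, of u k] xs' ys' k unfolding x_def y_def by simp
      next
        case False
        then show ?thesis using QC[of x v y u k] xs' ys' k Suc(2) unfolding x_def y_def v_def by simp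
      qed
      then obtain t where t: "nb t x" "nb t y" "d u t = k" by blast
      \<comment> \<open>The induction hypothesis reroutes both geodesics through \<open>t\<close>;
        afterwards they differ only in the square on \<open>t\<close>, \<open>x\<close>,
        \<open>v\<close>, \<open>y\<close>.\<close>
      obtain ts where ts: "geodesic u ts" "last ts = t" using geodesic_exists by blast
      then obtain ts' where ts': "ts = ts' @ [t]" using geodesic_nonempty by (metis append_butlast_last_id)
      have "geodesic u (ts @ [x])" "geodesic u (ts @ [y])"
        by (rule geodesic_step; use ts t xs' ys' k in \<open>simp add: x_def y_def\<close>)+
      then have hx: "htp xs' (ts @ [x])" and hy: "htp ys' (ts @ [y])"
        using IH xs' ys' unfolding x_def y_def by simp_all
      obtain c where c: "nb c t" "nb c x" "nb c y" "nb c v"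
        using fill[of t x v y] t xs' ys' unfolding x_def y_def by blast
      have "htp xs (ts' @ [t, x, v])"
        using htp_append_right[OF hx, of "[v]"] xs'(1) ts' by simp
      also have "htp \<dots> (ts' @ [t, y, v])"
        by (rule htp_square[OF c]) (use t xs' ys' x_def y_def in auto)
      also have "htp \<dots> ys"
        using htp_append_right[OF hy, of "[v]"] ys'(1) ts' htp_sym by simp
      finally show ?thesis .
    qed
  qed
  have to_geodesic: "\<exists>ys. geodesic (hd xs) ys \<and> last ys = last xs \<and> htp xs ys" if "xs \<noteq> []" "walk xs" for xs
    using that
  proof (induction xs rule: rev_nonempty_induct)
    case (single x)
    then show ?case using geodesic_start[of x] by (intro exI[of _ "[x]"]) simp
  next
    case (snoc v xs)
    define u where "u = hd xs"
    define x where "x = last xs"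
    have walk: "walk xs" "nb x v" using snoc unfolding x_def by (auto simp: successively_append_iff)
    then obtain ys where ys: "geodesic u ys" "last ys = x" "htp xs ys"
      using snoc.IH unfolding u_def x_def by blast
    have xv: "htp (xs @ [v]) (zs @ [x, v])" if "geodesic u (zs @ [x])" for zs
    proof -
      have "htp ys (zs @ [x])" using uniq[OF ys(1) that] ys(2) by simp
      then have "htp xs (zs @ [x])" using ys(3) htp_trans by blast
      then show ?thesis using htp_append_right[of xs _ "[v]"] by fastforce
    qed
    have "\<exists>ys. geodesic u ys \<and> last ys = v \<and> htp (xs @ [v]) ys"
    proof -
      \<comment> \<open>The last edge is degenerate, leads away from \<open>u\<close>, leads towards
        \<open>u\<close>, or is level. In the level case (TC) provides a triangle with apex
        \<open>t\<close> below it.\<close>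
      consider "x = v" | "d u v = Suc (d u x)" | "d u x = Suc (d u v)" | "x \<noteq> v" "d u x = d u v"
        using nb_gdist[OF walk(2), of u] nb_gdist[OF nb_sym[OF walk(2)], of u] by linarith
      then show ?thesis
      proof cases
        case 1
        obtain ys' where ys': "ys = ys' @ [x]" using ys geodesic_nonempty by (metis append_butlast_last_id)
        then have "htp (xs @ [v]) (ys' @ [x, x])" using xv[of ys'] ys(1) 1 by simp
        also have "htp \<dots> (ys' @ [x] @ [])" using htp_stutter[of ys' x "[]"] by simp
        finally show ?thesis using ys ys' 1 by auto
      next
        case 2
        then have "geodesic u (ys @ [v])" using geodesic_step[OF ys(1)] walk(2) ys(2) by simp
        then show ?thesis using htp_append_right[OF ys(3), of "[v]"] by fastforce
      next
        case 3
        obtain zs where zs: "geodesic u zs" "last zs = v" using geodesic_exists by blast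
        then obtain zs' where zs': "zs = zs' @ [v]" using geodesic_nonempty by (metis append_butlast_last_id)
        have "geodesic u (zs @ [x])" using geodesic_step[OF zs(1)] zs(2) 3 nb_sym[OF walk(2)] by simp
        then have "htp (xs @ [v]) (zs' @ [v, x, v])" using xv[of zs] zs' by simp
        also have "htp \<dots> (zs' @ [v])"
          using htp_append_left[OF htp_backtrack[of v x]] nb_sym[OF walk(2)] by blast
        finally show ?thesis using zs zs' by auto
      next
        case 4
        then have "d u x \<noteq> 0" by auto
        then obtain k where k: "d u x = Suc k" using not0_implies_Suc by blast
        then obtain t where t: "nb t x" "nb t v" "d u t = k" using TC[OF walk(2)] 4 by metis
        obtain ts where ts: "geodesic u ts" "last ts = t" using geodesic_exists by blast
        then obtain ts' where ts': "ts = ts' @ [t]" using geodesic_nonempty by (metis append_butlast_last_id)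
        have "geodesic u (ts @ [x])" "geodesic u (ts @ [v])"
          by (rule geodesic_step; use ts t k 4 in simp)+
        have "htp (xs @ [v]) (ts' @ [t, x, v] @ [])" using xv[OF \<open>geodesic u (ts @ [x])\<close>] ts' by simp
        also have "htp \<dots> (ts' @ [t, v] @ [])" by (rule htp_triangle) (use t walk(2) in auto)
        finally show ?thesis using \<open>geodesic u (ts @ [v])\<close> ts' by (intro exI[of _ "ts @ [v]"]) simp
      qed
    qed
    then show ?case using snoc.hyps unfolding u_def by simp
  qed
  show ?thesis
    unfolding simply_conn_def
  proof (intro allI impI)
    fix xs assume xs: "xs \<noteq> [] \<and> walk xs \<and> last xs = hd xs"
    then obtain ys where ys: "geodesic (hd xs) ys" "last ys = last xs" "htp xs ys" using to_geodesic by blast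
    with uniq[OF ys(1) geodesic_start] xs show "htp xs [hd xs]" using htp_trans by (metis last.simps)
  qed
qed

section \<open>Consequences of the Helly property\<close>

text \<open>By \<open>gdist_split\<close> two balls meet as soon as their radii add up to at least
  the distance of the centres, so the Helly property becomes a condition on centres and
  radii.\<close>

lemma Helly_balls:
  assumes "Helly E" and F: "\<And>x r y s. \<lbrakk>(x, r) \<in> F; (y, s) \<in> F\<rbrakk> \<Longrightarrow> d x y \<le> r + s"
  shows "\<exists>q. \<forall>(x, r)\<in>F. d x q \<le> r"
proof -
  define S where "S = (\<lambda>(x, r). gball E r x) ` F"
  have "A \<inter> B \<noteq> {}" if AB: "A \<in> S" "B \<in> S" for A B
  proof -
    obtain x r y s where "(x, r) \<in> F" "(y, s) \<in> F" and eq: "A = gball E r x" "B = gball E s y"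
      using AB unfolding S_def by auto
    then obtain z where "d x z \<le> r" "d z y \<le> s" using F gdist_split by blast
    then have "z \<in> A \<inter> B" unfolding eq gball_def by (simp add: gdist_sym)
    then show ?thesis by blast
  qed
  moreover have "S \<subseteq> {gball E r v | r v. True}" unfolding S_def by auto
  ultimately have "\<Inter>S \<noteq> {}" using assms(1) unfolding Helly_def Helly_family_def by simp
  then obtain q where "\<And>A. A \<in> S \<Longrightarrow> q \<in> A" by blast
  then have "d x q \<le> r" if "(x, r) \<in> F" for x r
    using that unfolding S_def gball_def by force
  then show ?thesis by blast
qed

lemma BFS_dominated_if_Helly:
  assumes "Helly E"
  shows "BFS_dominated E u"
  unfolding BFS_dominated_def
proof (intro allI impI)
  fix v assume "v \<noteq> u"
  then have "d u v \<noteq> 0" by simp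
  then obtain k where k: "d u v = Suc k" using not0_implies_Suc by blast
  define B where "B = {x. nb v x \<and> d u x \<le> d u v}"
  have "\<exists>q. \<forall>(x, r)\<in>insert (u, k) (B \<times> {1}). d x q \<le> r"
  proof (rule Helly_balls[OF assms])
    have "d x y \<le> 1 + 1" if "x \<in> B" "y \<in> B" for x y
    proof -
      have "d x v \<le> 1" "d v y \<le> 1" using that nb_sym unfolding gdist_le_1 B_def by blast+
      then show ?thesis using gdist_triangle[of x y v] by linarith
    qed
    moreover have "d u x \<le> k + 1" "d x u \<le> 1 + k" if "x \<in> B" for x
      using that k gdist_sym[of u x] unfolding B_def by auto
    ultimately show "d x y \<le> r + s"
      if "(x, r) \<in> insert (u, k) (B \<times> {1})" "(y, s) \<in> insert (u, k) (B \<times> {1})" for x r y s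
      using that by fastforce
  qed
  then obtain q where q: "d u q \<le> k" "\<And>x. x \<in> B \<Longrightarrow> d x q \<le> 1" by auto
  then have "nb q x" if "x \<in> B" for x using that nb_sym unfolding gdist_le_1 by blast
  \<comment> \<open>Nearness of \<open>q\<close> to \<open>v\<close> keeps it from being closer to
    \<open>u\<close> than \<open>k\<close>.\<close>
  moreover have "v \<in> B" unfolding B_def by simp
  ultimately have "d u v \<le> Suc (d u q)" using nb_gdist by blast
  with k q(1) have "d u v = Suc (d u q)" by simp
  with \<open>\<And>x. x \<in> B \<Longrightarrow> nb q x\<close>
  show "\<exists>w. d u v = Suc (d u w) \<and> (\<forall>x. nb v x \<and> d u x \<le> d u v \<longrightarrow> nb w x)"
    unfolding B_def by blast
qed

lemma one_Helly_if_Helly: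
  assumes "Helly E"
  shows "one_Helly E"
  unfolding one_Helly_def Helly_family_def
proof (intro allI impI)
  fix S assume S: "S \<subseteq> {gball E 1 v | v. True} \<and> (\<forall>A\<in>S. \<forall>B\<in>S. A \<inter> B \<noteq> {})"
  then have "S \<subseteq> {gball E r v | r v. True}" by blast
  with S assms show "\<Inter>S \<noteq> {}" unfolding Helly_def Helly_family_def by simp
qed

text \<open>The unit balls about all vertices of the cliques meet pairwise in vertices shared by two
  cliques. A point common to these balls extends each clique, hence belongs to it by
  maximality.\<close>

lemma clique_Helly_if_one_Helly:
  assumes "one_Helly E"
  shows "clique_Helly E"
  unfolding clique_Helly_def Helly_family_def
proof (intro allI impI)
  fix S assume S: "S \<subseteq> {C. maximal_clique E C} \<and> (\<forall>A\<in>S. \<forall>B\<in>S. A \<inter> B \<noteq> {})"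
  define T where "T = gball E 1 ` \<Union>S"
  have cl: "clique E C" if "C \<in> S" for C using that S unfolding maximal_clique_def by blast
  have "A \<inter> B \<noteq> {}" if AB: "A \<in> T" "B \<in> T" for A B
  proof -
    obtain x y C D where xy: "x \<in> C" "C \<in> S" "y \<in> D" "D \<in> S" "A = gball E 1 x" "B = gball E 1 y"
      using AB unfolding T_def by blast
    then have "C \<inter> D \<noteq> {}" using S by blast
    then obtain z where z: "z \<in> C" "z \<in> D" by blast
    then have "z \<in> A" "z \<in> B" using xy cl unfolding xy(5,6) gball_1 clique_near by blast+
    then show ?thesis by blast
  qed
  then have "T \<subseteq> {gball E 1 v | v. True} \<and> (\<forall>A\<in>T. \<forall>B\<in>T. A \<inter> B \<noteq> {})"
    unfolding T_def by auto
  then have "\<Inter>T \<noteq> {}"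
    by (rule assms[unfolded one_Helly_def Helly_family_def, THEN spec, THEN mp])
  then obtain q where q: "\<And>A. A \<in> T \<Longrightarrow> q \<in> A" by blast
  have "q \<in> C" if C: "C \<in> S" for C
  proof -
    have "nb q x" if x: "x \<in> C" for x
    proof -
      have "q \<in> gball E 1 x" using q C x unfolding T_def by blast
      then show ?thesis unfolding gball_1 by (rule nb_sym)
    qed
    then have "clique E (insert q C)" using cl[OF C] unfolding clique_insert by blast
    then show ?thesis using S C unfolding maximal_clique_def by blast
  qed
  then show "\<Inter>S \<noteq> {}" by blast
qed

text \<open>For (TC) the dominator of \<open>v\<close> works. For (QC) domination is used twice: for
  \<open>z\<close>, giving \<open>z'\<close> on the level of \<open>v\<close> and \<open>w\<close>,
  and then for \<open>z'\<close>.\<close>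

lemma weakly_modular_if_dominated:
  assumes dom: "\<And>u. BFS_dominated E u"
  shows "weakly_modular E"
proof -
  have down: "\<exists>w. d u v = Suc (d u w) \<and> (\<forall>x. nb v x \<and> d u x \<le> d u v \<longrightarrow> nb w x)"
    if "0 < d u v" for u v
    using that dom[of u] unfolding BFS_dominated_def by force
  show ?thesis
    unfolding weakly_modular_def
  proof (intro conjI allI impI)
    fix u v w assume h: "E v w \<and> 1 < d u v \<and> d u v = d u w"
    then obtain x where x: "d u v = Suc (d u x)" "\<And>y. nb v y \<Longrightarrow> d u y \<le> d u v \<Longrightarrow> nb x y"
      using down[of u v] by auto
    have "nb x v" "nb x w" using x(2) h by (auto simp: near_def)
    moreover have "x \<noteq> v" "x \<noteq> w" using x(1) h by auto
    ultimately show "\<exists>x. E x v \<and> E x w \<and> d u x = d u v - 1" using x(1) by (auto simp: near_def)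
  next
    fix u v w z
    assume h: "E v z \<and> E w z \<and> d v w = 2 \<and> 2 \<le> d u v \<and> d u v = d u w \<and> d u z = d u v + 1"
    then obtain z' where z': "d u z = Suc (d u z')" "\<And>y. nb z y \<Longrightarrow> d u y \<le> d u z \<Longrightarrow> nb z' y"
      using down[of u z] by auto
    have "nb z' v" "nb z' w" using z'(2) h sym by (auto simp: near_def)
    moreover have "d u z' = d u v" using z'(1) h by simp
    moreover obtain x where x: "d u z' = Suc (d u x)" "\<And>y. nb z' y \<Longrightarrow> d u y \<le> d u z' \<Longrightarrow> nb x y"
      using down[of u z'] h \<open>d u z' = d u v\<close> by auto
    ultimately have "nb x v" "nb x w" using h by auto
    moreover have "x \<noteq> v" "x \<noteq> w" using x(1) h \<open>d u z' = d u v\<close> by auto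
    ultimately show "\<exists>x. E x v \<and> E x w \<and> d u x = d u v - 1"
      using x(1) \<open>d u z' = d u v\<close> by (auto simp: near_def)
  qed
qed

text \<open>Vertices are ordered by distance from \<open>u\<close>, ties being broken by an
  arbitrary well-order. The predecessors of \<open>v\<close> then lie in the ball in which
  \<open>v\<close> is dominated.\<close>

lemma dismantlable_if_dominated:
  assumes dom: "BFS_dominated E u"
  shows "dismantlable E"
proof -
  obtain r0 :: "'a rel" where r0: "Well_order r0" "Field r0 = UNIV"
    using well_ordering[where 'a='a] by (auto simp: well_order_on_Field)
  have wf0: "wf (r0 - Id)" and lin0: "Linear_order r0"
    using r0(1) unfolding well_order_on_def by blast+
  have refl0: "(x, x) \<in> r0" for x
    using lin0 r0(2) unfolding order_on_defs refl_on_def by simp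
  have trans0: "trans r0" and antisym0: "antisym r0"
    using lin0 unfolding order_on_defs by blast+
  have total0: "(x, y) \<in> r0 \<or> (y, x) \<in> r0" for x y
    using lin0 r0(2) refl0 unfolding order_on_defs total_on_def by (metis UNIV_I)
  define r where "r = {(x, y). d u x < d u y \<or> d u x = d u y \<and> (x, y) \<in> r0}"
  have "refl r" unfolding refl_on_def r_def using refl0 by simp
  moreover have "trans r" unfolding r_def trans_def using transD[OF trans0] by auto
  moreover have "antisym r" unfolding r_def antisym_def using antisymD[OF antisym0] by auto
  moreover have "total r" unfolding total_on_def r_def using total0 by (auto simp: neq_iff)
  moreover have "wf (r - Id)"
  proof (rule wf_subset)
    show "wf (inv_image (less_than <*lex*> (r0 - Id)) (\<lambda>x. (d u x, x)))"
      using wf0 by (intro wf_inv_image wf_lex_prod) auto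
  qed (auto simp: r_def)
  moreover have F: "Field r = UNIV" using \<open>refl r\<close> unfolding refl_on_def Field_def by blast
  ultimately have "Well_order r" unfolding order_on_defs well_order_on_def by simp
  have "\<exists>w. (w, v) \<in> r \<and> w \<noteq> v \<and> E w v \<and> (\<forall>x. (x, v) \<in> r \<and> (x = v \<or> E x v) \<longrightarrow> x = w \<or> E x w)"
    if h: "\<exists>t. (t, v) \<in> r \<and> t \<noteq> v" for v
  proof -
    have "v \<noteq> u" using h by (auto simp: r_def)
    then obtain w where w: "d u v = Suc (d u w)" "\<And>x. nb v x \<Longrightarrow> d u x \<le> d u v \<Longrightarrow> nb w x"
      using dom unfolding BFS_dominated_def by blast
    have "w \<noteq> v" using w(1) by auto
    moreover have "nb w v" using w(2) by simp
    ultimately have "E w v" by (simp add: near_def)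
    moreover have "x = w \<or> E x w" if "(x, v) \<in> r" "x = v \<or> E x v" for x
    proof -
      have "d u x \<le> d u v" using that(1) by (auto simp: r_def)
      moreover have "nb v x" using that(2) sym by (auto simp: near_def)
      ultimately have "nb w x" using w(2) by blast
      then show ?thesis using sym by (auto simp: near_def)
    qed
    moreover have "(w, v) \<in> r" using w(1) by (simp add: r_def)
    ultimately show ?thesis using \<open>w \<noteq> v\<close> by blast
  qed
  with \<open>Well_order r\<close> F show ?thesis unfolding dismantlable_def by blast
qed

end

section \<open>The topology of the clique complex\<close>

lemma topspace_clique_complex [simp]:
  "topspace (clique_complex_topology E) = realization E"
proof -
  have "openin (clique_complex_topology E) (realization E)"
    unfolding openin_clique_complex_topology by (auto simp: closed_simplex_def Int_absorb1)
  then have "realization E \<subseteq> topspace (clique_complex_topology E)" by (rule openin_subset)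
  moreover have "topspace (clique_complex_topology E) \<subseteq> realization E"
    using openin_topspace[of "clique_complex_topology E"]
    unfolding openin_clique_complex_topology by (rule conjunct1)
  ultimately show ?thesis by (rule antisym[rotated])
qed

text \<open>Each piece is mapped into one closed simplex, where the weak topology is no finer than
  the Euclidean one, so coordinatewise continuity suffices. Finitely many closed pieces can be
  pasted.\<close>

lemma continuous_map_into_clique_complex:
  fixes g :: "'b \<Rightarrow> 'a \<Rightarrow> real"
  assumes "finite J" and clo: "\<And>j. j \<in> J \<Longrightarrow> closedin Y (K j)"
    and cover: "\<And>y. y \<in> topspace Y \<Longrightarrow> \<exists>j\<in>J. y \<in> K j"
    and simplex: "\<And>j. j \<in> J \<Longrightarrow> finite (\<sigma> j) \<and> clique E (\<sigma> j)"
    and into: "\<And>j y. \<lbrakk>j \<in> J; y \<in> K j\<rbrakk> \<Longrightarrow> g y \<in> closed_simplex E (\<sigma> j)"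
    and cont: "\<And>v. continuous_map Y euclideanreal (\<lambda>y. g y v)"
  shows "continuous_map Y (clique_complex_topology E) g"
proof (rule pasting_lemma_closed[where I = J and T = K and f = "\<lambda>_. g"])
  fix j assume j: "j \<in> J"
  let ?Y = "subtopology Y (K j)"
  have "continuous_map Y euclidean g"
    unfolding euclidean_product_topology[symmetric] continuous_map_componentwise_UNIV
    using cont by blast
  then have "continuous_map ?Y (top_of_set (closed_simplex E (\<sigma> j))) g"
    using into[OF j] by (intro continuous_map_into_subtopology continuous_map_from_subtopology) auto
  then have pre: "openin ?Y {y \<in> topspace ?Y. g y \<in> U}"
    if "openin (top_of_set (closed_simplex E (\<sigma> j))) U" for U
    using that by (rule openin_continuous_map_preimage)
  show "continuous_map ?Y (clique_complex_topology E) g"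
    unfolding continuous_map
  proof (intro conjI allI impI)
    show "g ` topspace ?Y \<subseteq> topspace (clique_complex_topology E)"
      using into[OF j] by (auto simp: closed_simplex_def)
    fix U assume "openin (clique_complex_topology E) U"
    then have opn: "openin (top_of_set (closed_simplex E (\<sigma> j))) (U \<inter> closed_simplex E (\<sigma> j))"
      using simplex[OF j] unfolding openin_clique_complex_topology by blast
    have eq: "{y \<in> topspace ?Y. g y \<in> U} = {y \<in> topspace ?Y. g y \<in> U \<inter> closed_simplex E (\<sigma> j)}"
      using into[OF j] by auto
    show "openin ?Y {y \<in> topspace ?Y. g y \<in> U}" unfolding eq by (rule pre[OF opn])
  qed
qed (use assms(1) clo cover in auto)

text \<open>For coefficients \<open>c\<close> of the form \<open>1, \<dots>, 1, s, 0, \<dots>, 0\<close> with \<open>s\<close> in position \<open>j\<close>, this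
  telescoping sum is the point dividing the edge from \<open>x j\<close> to \<open>x (Suc j)\<close> in the ratio
  \<open>s : 1 - s\<close>, while its dependence on \<open>c\<close> is visibly continuous.\<close>
definition tele :: "(nat \<Rightarrow> 'a) \<Rightarrow> nat \<Rightarrow> (nat \<Rightarrow> real) \<Rightarrow> 'a \<Rightarrow> real" where
  "tele x n c v = of_bool (v = x 0) + (\<Sum>i<n. c i * (of_bool (v = x (Suc i)) - of_bool (v = x i)))"

lemma tele_ones: "(\<And>i. i < n \<Longrightarrow> c i = 1) \<Longrightarrow> tele x n c v = of_bool (v = x n)"
  using sum_lessThan_telescope[of "\<lambda>i. of_bool (v = x i) :: real" n] by (simp add: tele_def)

lemma tele_edge:
  assumes "j < n" "\<And>i. i < j \<Longrightarrow> c i = 1" "\<And>i. \<lbrakk>j < i; i < n\<rbrakk> \<Longrightarrow> c i = 0"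
  shows "tele x n c v = (1 - c j) * of_bool (v = x j) + c j * of_bool (v = x (Suc j))"
proof -
  let ?h = "\<lambda>i. c i * (of_bool (v = x (Suc i)) - of_bool (v = x i))"
  have "sum ?h {..<n} = sum ?h {..<Suc j}"
    by (rule sum.mono_neutral_right) (use assms in \<open>auto simp: not_less_eq\<close>)
  then have "tele x n c v = tele x j c v + ?h j" by (simp add: tele_def)
  also have "tele x j c v = of_bool (v = x j)" by (rule tele_ones) (use assms in auto)
  finally show ?thesis by (simp add: algebra_simps)
qed

lemma closed_simplexI:
  assumes "finite \<sigma>" "clique E \<sigma>" "\<And>x. 0 \<le> f x" "\<And>x. x \<notin> \<sigma> \<Longrightarrow> f x = 0" "sum f \<sigma> = 1"
  shows "f \<in> closed_simplex E \<sigma>"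
proof -
  have supp: "{x. f x \<noteq> 0} \<subseteq> \<sigma>" using assms(4) by blast
  have "sum f {x. f x \<noteq> 0} = sum f \<sigma>"
    by (rule sum.mono_neutral_left) (use assms(1) supp in auto)
  moreover have "clique E {x. f x \<noteq> 0}" using assms(2) supp unfolding clique_def by blast
  ultimately show ?thesis
    using assms(3,5) supp finite_subset[OF supp assms(1)]
    unfolding closed_simplex_def realization_def by simp
qed

text \<open>The straight-line homotopy between two contiguous vertex maps \<open>p\<close> and
  \<open>q\<close>.\<close>

lemma segments_in_closed_simplex:
  fixes p q :: "'b \<Rightarrow> 'a" and f :: "'b \<Rightarrow> real"
  assumes "finite S" and f: "\<And>a. a \<in> S \<Longrightarrow> 0 \<le> f a" "sum f S = 1"
    and s: "0 \<le> s" "s \<le> 1" and cl: "clique E (p ` S \<union> q ` S)"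
  shows "(\<lambda>v. \<Sum>a\<in>S. f a * ((1 - s) * of_bool (v = p a) + s * of_bool (v = q a)))
          \<in> closed_simplex E (p ` S \<union> q ` S)" (is "?g \<in> closed_simplex E ?\<tau>")
proof (rule closed_simplexI)
  show fin: "finite ?\<tau>" using assms(1) by simp
  show "0 \<le> ?g x" for x using f(1) s by (intro sum_nonneg) auto
  show "?g x = 0" if "x \<notin> ?\<tau>" for x using that by (intro sum.neutral) auto
  have one: "(\<Sum>v\<in>?\<tau>. of_bool (v = y) :: real) = 1" if "y \<in> ?\<tau>" for y
    using fin that by (simp add: of_bool_def sum.delta)
  have "sum ?g ?\<tau> = (\<Sum>a\<in>S. \<Sum>v\<in>?\<tau>. f a * ((1 - s) * of_bool (v = p a) + s * of_bool (v = q a)))"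
    by (rule sum.swap)
  also have "\<dots> = (\<Sum>a\<in>S. f a)"
  proof (rule sum.cong)
    fix a assume "a \<in> S"
    then have "(\<Sum>v\<in>?\<tau>. of_bool (v = p a) :: real) = 1" "(\<Sum>v\<in>?\<tau>. of_bool (v = q a) :: real) = 1"
      using one by blast+
    then show "(\<Sum>v\<in>?\<tau>. f a * ((1 - s) * of_bool (v = p a) + s * of_bool (v = q a))) = f a"
      by (simp only: sum_distrib_left[symmetric] sum.distrib) simp
  qed simp
  finally show "sum ?g ?\<tau> = 1" using f(2) by simp
qed (rule cl)

section \<open>Homotopies out of the clique complex\<close>

text \<open>A contraction moves a loop through loops, since its two ends are the same point at all
  times. Homotopies of loops are free, so any two loops are joined through a constant one.\<close>

lemma contractible_imp_simply_connected_space: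
  assumes "contractible_space X"
  shows "simply_connected_space X"
proof -
  obtain a where "homotopic_with (\<lambda>x. True) X X id (\<lambda>x. a)"
    using assms unfolding contractible_space_def by blast
  then obtain h where h: "continuous_map (prod_topology (top_of_set {0..1::real}) X) X h"
    "\<And>x. h (0, x) = x" "\<And>x. h (1, x) = a"
    unfolding homotopic_with_def by auto
  have null: "homotopic_with (\<lambda>r. r 1 = r 0) (top_of_set {0..1::real}) X p (\<lambda>_. a)"
    if p: "pathin X p" "p 1 = p 0" for p
    unfolding homotopic_with_def
  proof (intro exI conjI)
    have "continuous_map (prod_topology (top_of_set {0..1}) (top_of_set {0..1}))
            (prod_topology (top_of_set {0..1}) X) (\<lambda>z. (fst z, p (snd z)))"
      using p(1) unfolding pathin_def
      by (intro continuous_map_pairedI continuous_map_fst continuous_map_compose[OF continuous_map_snd, unfolded o_def])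
    from continuous_map_compose[OF this h(1)]
    show "continuous_map (prod_topology (top_of_set {0..1}) (top_of_set {0..1})) X
            (\<lambda>z. h (fst z, p (snd z)))" by (simp add: o_def)
  qed (use h p in auto)
  show ?thesis
    unfolding simply_connected_space_def
    using null homotopic_with_trans homotopic_with_symD by blast
qed

lemma quotient_map_simplices:
  "quotient_map (sum_topology (\<lambda>\<sigma>. top_of_set (closed_simplex E \<sigma>)) {\<sigma>. finite \<sigma> \<and> clique E \<sigma>})
     (clique_complex_topology E) snd" (is "quotient_map ?Q _ _")
  unfolding quotient_map_def
proof (intro conjI allI impI)
  have top: "topspace ?Q = (SIGMA \<sigma>:{\<sigma>. finite \<sigma> \<and> clique E \<sigma>}. closed_simplex E \<sigma>)"
    by (auto simp: o_def)
  have "\<exists>\<sigma>. finite \<sigma> \<and> clique E \<sigma> \<and> f \<in> closed_simplex E \<sigma>" if "f \<in> realization E" for f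
    using that by (intro exI[of _ "{x. f x \<noteq> 0}"]) (auto simp: closed_simplex_def realization_def)
  then show "snd ` topspace ?Q = topspace (clique_complex_topology E)"
    unfolding top by (force simp: closed_simplex_def image_iff)
  fix U :: "('a \<Rightarrow> real) set" assume "U \<subseteq> topspace (clique_complex_topology E)"
  moreover have "{f. (\<sigma>, f) \<in> {x \<in> topspace ?Q. snd x \<in> U}} = U \<inter> closed_simplex E \<sigma>"
    if "finite \<sigma> \<and> clique E \<sigma>" for \<sigma>
    using that unfolding top by auto
  ultimately show "openin ?Q {x \<in> topspace ?Q. snd x \<in> U} \<longleftrightarrow> openin (clique_complex_topology E) U"
    unfolding openin_sum_topology openin_clique_complex_topology by auto
qed

text \<open>The complex is a quotient of the disjoint union of its simplices, and the product with a
  compact Hausdorff interval preserves quotient maps. No local finiteness is required.\<close>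

lemma continuous_map_clique_complex_prod:
  assumes cont: "\<And>\<sigma>. finite \<sigma> \<and> clique E \<sigma> \<Longrightarrow>
    continuous_map (prod_topology (top_of_set {0..1::real}) (top_of_set (closed_simplex E \<sigma>))) Z h"
  shows "continuous_map (prod_topology (top_of_set {0..1}) (clique_complex_topology E)) Z h"
proof -
  let ?I = "top_of_set {0..1::real}"
  let ?X = "\<lambda>\<sigma>. top_of_set (closed_simplex E \<sigma>)"
  let ?S = "{\<sigma>. finite \<sigma> \<and> clique E \<sigma>}"
  let ?Q = "sum_topology ?X ?S"
  let ?q = "\<lambda>(t, y). (t, snd y) :: real \<times> ('a \<Rightarrow> real)"
  have "compact_space ?I" by (simp add: compact_space_subtopology)
  moreover have "Hausdorff_space ?I" by (simp add: Hausdorff_space_subtopology)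
  ultimately have quot: "quotient_map (prod_topology ?I ?Q) (prod_topology ?I (clique_complex_topology E)) ?q"
    by (intro quotient_map_prod_right quotient_map_simplices compact_imp_locally_compact_space) auto
  have "continuous_map (prod_topology ?I ?Q) Z (h \<circ> ?q)"
    unfolding continuous_map
  proof (intro conjI allI impI)
    have top: "(t, \<sigma>, f) \<in> topspace (prod_topology ?I ?Q) \<longleftrightarrow>
        finite \<sigma> \<and> clique E \<sigma> \<and> (t, f) \<in> topspace (prod_topology ?I (?X \<sigma>))" for t \<sigma> f
      by auto
    show "(h \<circ> ?q) ` topspace (prod_topology ?I ?Q) \<subseteq> topspace Z"
    proof clarify
      fix t \<sigma> f assume "(t, \<sigma>, f) \<in> topspace (prod_topology ?I ?Q)"
      then have "finite \<sigma> \<and> clique E \<sigma>" "(t, f) \<in> topspace (prod_topology ?I (?X \<sigma>))" using top by blast+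
      with cont[of \<sigma>] have "h (t, f) \<in> topspace Z" unfolding continuous_map by blast
      then show "(h \<circ> ?q) (t, \<sigma>, f) \<in> topspace Z" by simp
    qed
    fix U assume U: "openin Z U"
    show "openin (prod_topology ?I ?Q) {x \<in> topspace (prod_topology ?I ?Q). (h \<circ> ?q) x \<in> U}"
      unfolding openin_prod_topology_alt
    proof (intro allI impI)
      fix t y assume ty: "(t, y) \<in> {x \<in> topspace (prod_topology ?I ?Q). (h \<circ> ?q) x \<in> U}"
      obtain \<sigma> f where y: "y = (\<sigma>, f)" by fastforce
      with ty top have \<sigma>: "finite \<sigma> \<and> clique E \<sigma>"
        and tf: "(t, f) \<in> {x \<in> topspace (prod_topology ?I (?X \<sigma>)). h x \<in> U}" by auto
      have "openin (prod_topology ?I (?X \<sigma>)) {x \<in> topspace (prod_topology ?I (?X \<sigma>)). h x \<in> U}"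
        using cont[OF \<sigma>] U by (rule openin_continuous_map_preimage)
      then obtain A B where AB: "openin ?I A" "openin (?X \<sigma>) B" "t \<in> A" "f \<in> B"
        "A \<times> B \<subseteq> {x \<in> topspace (prod_topology ?I (?X \<sigma>)). h x \<in> U}"
        using tf unfolding openin_prod_topology_alt by meson
      have "openin ?Q ({\<sigma>} \<times> B)"
        unfolding openin_sum_topology
      proof (intro conjI ballI)
        show "{\<sigma>} \<times> B \<subseteq> Sigma ?S (topspace \<circ> ?X)"
          using \<sigma> openin_subset[OF AB(2)] by auto
        show "openin (?X i) {x. (i, x) \<in> {\<sigma>} \<times> B}" if "i \<in> ?S" for i
          using AB(2) by (cases "i = \<sigma>") auto
      qed
      moreover have "A \<times> ({\<sigma>} \<times> B) \<subseteq> {x \<in> topspace (prod_topology ?I ?Q). (h \<circ> ?q) x \<in> U}"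
        using AB(5) \<sigma> top by auto
      ultimately show "\<exists>A B. openin ?I A \<and> openin ?Q B \<and> t \<in> A \<and> y \<in> B \<and>
          A \<times> B \<subseteq> {x \<in> topspace (prod_topology ?I ?Q). (h \<circ> ?q) x \<in> U}"
        using AB y by blast
    qed
  qed
  then show ?thesis by (rule continuous_compose_quotient_map[OF quot])
qed

lemma openin_star: "openin (clique_complex_topology E) {f \<in> realization E. 0 < f v}"
  unfolding openin_clique_complex_topology
proof (intro conjI allI impI)
  fix \<sigma>
  have "open {f :: 'a \<Rightarrow> real. 0 < f v}"
    by (intro open_Collect_less continuous_on_const continuous_on_product_coordinates)
  then have "openin (top_of_set (closed_simplex E \<sigma>)) (closed_simplex E \<sigma> \<inter> {f. 0 < f v})"
    by (rule openin_open_Int)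
  moreover have "closed_simplex E \<sigma> \<inter> {f. 0 < f v} = {f \<in> realization E. 0 < f v} \<inter> closed_simplex E \<sigma>"
    by (auto simp: closed_simplex_def)
  ultimately show "openin (top_of_set (closed_simplex E \<sigma>)) ({f \<in> realization E. 0 < f v} \<inter> closed_simplex E \<sigma>)"
    by simp
qed auto

lemma closed_simplexD:
  assumes "f \<in> closed_simplex E \<sigma>" "finite \<sigma>"
  shows "0 \<le> f x" "x \<notin> \<sigma> \<Longrightarrow> f x = 0" "sum f \<sigma> = 1"
proof -
  have f: "\<forall>x. 0 \<le> f x" "sum f {x. f x \<noteq> 0} = 1" "{x. f x \<noteq> 0} \<subseteq> \<sigma>"
    using assms(1) unfolding closed_simplex_def realization_def by auto
  show "0 \<le> f x" "x \<notin> \<sigma> \<Longrightarrow> f x = 0" using f by auto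
  have "sum f {x. f x \<noteq> 0} = sum f \<sigma>"
    by (rule sum.mono_neutral_left) (use assms(2) f(3) in auto)
  with f(2) show "sum f \<sigma> = 1" by simp
qed

text \<open>The retraction from level \<open>i + 1\<close> to level \<open>i\<close> is performed during the time interval from
  \<open>1 / (i + 2)\<close> to \<open>1 / (i + 1)\<close>, so that every simplex is at rest near time \<open>0\<close>.\<close>
definition clock :: "real \<Rightarrow> nat \<Rightarrow> real" where
  "clock t i = min 1 (max 0 ((real i + 2) * (1 - (real i + 1) * t)))"

lemma clock_bounds: "0 \<le> clock t i" "clock t i \<le> 1"
  by (simp_all add: clock_def)

lemma clock_one: "(real i + 2) * t \<le> 1 \<Longrightarrow> clock t i = 1"
proof -
  assume "(real i + 2) * t \<le> 1"
  then have "(real i + 1) * ((real i + 2) * t) \<le> (real i + 1) * 1"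
    by (intro mult_left_mono) auto
  then have "1 \<le> (real i + 2) * (1 - (real i + 1) * t)" by (simp add: algebra_simps)
  then show ?thesis by (simp add: clock_def)
qed

lemma clock_zero: "1 \<le> (real i + 1) * t \<Longrightarrow> clock t i = 0"
proof -
  assume "1 \<le> (real i + 1) * t"
  then have "(real i + 2) * (1 - (real i + 1) * t) \<le> 0" by (intro mult_nonneg_nonpos) auto
  then show ?thesis by (simp add: clock_def)
qed

text \<open>For \<open>j < N\<close> this is the interval in which level \<open>j\<close> moves;
  phase \<open>N\<close> is the initial rest of everything within distance \<open>N\<close>. Thus
  finitely many closed phases cover the unit interval.\<close>

definition clock_phase :: "nat \<Rightarrow> nat \<Rightarrow> real \<Rightarrow> bool" where
  "clock_phase N j t \<longleftrightarrow> (real j + 1) * t \<le> 1 \<and> (j < N \<longrightarrow> 1 \<le> (real j + 2) * t)"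

lemma clock_phase_exists: "t \<le> 1 \<Longrightarrow> \<exists>j\<le>N. clock_phase N j t"
proof (induction N)
  case 0
  then show ?case by (simp add: clock_phase_def)
next
  case (Suc N)
  then obtain j where j: "j \<le> N" "clock_phase N j t" by blast
  show ?case
  proof (cases "j < N \<or> 1 \<le> (real j + 2) * t")
    case True
    then have "clock_phase (Suc N) j t" using j unfolding clock_phase_def by auto
    then show ?thesis using j(1) by (intro exI[of _ j]) simp
  next
    case False
    then have "j = N" "(real (Suc N) + 1) * t \<le> 1" using j(1) by (auto simp: algebra_simps)
    then have "clock_phase (Suc N) (Suc N) t" by (simp add: clock_phase_def)
    then show ?thesis by blast
  qed
qed

lemma clock_before:
  assumes "clock_phase N j t" "0 \<le> t" "i < j"
  shows "clock t i = 1"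
proof (rule clock_one)
  have "(real i + 2) * t \<le> (real j + 1) * t" using assms by (intro mult_right_mono) auto
  then show "(real i + 2) * t \<le> 1" using assms(1) by (simp add: clock_phase_def)
qed

lemma clock_after:
  assumes "clock_phase N j t" "0 \<le> t" "j < i" "j < N"
  shows "clock t i = 0"
proof (rule clock_zero)
  have "(real j + 2) * t \<le> (real i + 1) * t" using assms by (intro mult_right_mono) auto
  then show "1 \<le> (real i + 1) * t" using assms(1,4) by (simp add: clock_phase_def)
qed

context connected_graph
begin

section \<open>Contractibility\<close>

definition radial_path :: "'a \<Rightarrow> 'a \<Rightarrow> real \<Rightarrow> 'a \<Rightarrow> real" where
  "radial_path u a t = tele (\<lambda>j. radial u j a) (d u a) (clock t)"

definition radial_homotopy :: "'a \<Rightarrow> real \<times> ('a \<Rightarrow> real) \<Rightarrow> 'a \<Rightarrow> real" where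
  "radial_homotopy u z v = (\<Sum>a | snd z a \<noteq> 0. snd z a * radial_path u a (fst z) v)"

text \<open>In phase \<open>j\<close> all vertices within \<open>N\<close> pass from level
  \<open>Suc j\<close> to level \<open>j\<close> in the same ratio. For a vertex within distance
  \<open>j\<close> both end points are the vertex itself.\<close>

lemma radial_path_edge:
  assumes "clock_phase N j t" "0 \<le> t" "d u a \<le> N" "j \<le> N"
  shows "radial_path u a t v =
    (1 - clock t j) * of_bool (v = radial u j a) + clock t j * of_bool (v = radial u (Suc j) a)"
proof (cases "j < d u a")
  case True
  then show ?thesis
    unfolding radial_path_def
    by (intro tele_edge) (use assms clock_before clock_after in auto)
next
  case False
  then have "radial_path u a t v = of_bool (v = radial u (d u a) a)"
    unfolding radial_path_def by (intro tele_ones) (use assms clock_before in auto)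
  with False show ?thesis by (simp add: radial_id)
qed

lemma radial_homotopy_simplex:
  assumes "f \<in> closed_simplex E \<sigma>" "finite \<sigma>"
  shows "radial_homotopy u (t, f) v = (\<Sum>a\<in>\<sigma>. f a * radial_path u a t v)"
  unfolding radial_homotopy_def
  by (simp, rule sum.mono_neutral_left) (use assms(2) closed_simplexD(2)[OF assms] in auto)

lemma continuous_radial_homotopy:
  assumes dom: "BFS_dominated E u"
  shows "continuous_map (prod_topology (top_of_set {0..1}) (clique_complex_topology E))
           (clique_complex_topology E) (radial_homotopy u)"
proof (rule continuous_map_clique_complex_prod)
  fix \<sigma> assume \<sigma>: "finite \<sigma> \<and> clique E \<sigma>"
  \<comment> \<open>Any bound on the distances of the vertices of the simplex would do; it makes the
    number of phases finite.\<close>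
  define N where "N = (\<Sum>a\<in>\<sigma>. d u a)"
  have N: "d u a \<le> N" if "a \<in> \<sigma>" for a
    unfolding N_def using \<sigma> that by (intro member_le_sum) auto
  let ?S = "{0..1::real} \<times> closed_simplex E \<sigma>"
  define K where "K j = ?S \<inter> {z. clock_phase N j (fst z)}" for j
  define \<tau> where "\<tau> j = radial u j ` \<sigma> \<union> radial u (Suc j) ` \<sigma>" for j
  have "continuous_map (top_of_set ?S) (clique_complex_topology E) (radial_homotopy u)"
  proof (rule continuous_map_into_clique_complex[where J = "{..N}" and K = K and \<sigma> = \<tau>])
    fix j assume "j \<in> {..N}"
    have "closed {z :: real \<times> ('a \<Rightarrow> real). (real j + 1) * fst z \<le> 1}"
      "closed {z :: real \<times> ('a \<Rightarrow> real). 1 \<le> (real j + 2) * fst z}"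
      by (intro closed_Collect_le continuous_intros)+
    then have "closed {z :: real \<times> ('a \<Rightarrow> real). clock_phase N j (fst z)}"
      unfolding clock_phase_def by (cases "j < N") (simp_all add: closed_Collect_conj)
    then show "closedin (top_of_set ?S) (K j)"
      unfolding K_def by (rule closedin_closed_Int)
    \<comment> \<open>\<open>radial_near\<close> makes the images at two consecutive levels a
      clique, so the whole phase stays in one closed simplex.\<close>
    have "nb x y" if "x \<in> \<tau> j" "y \<in> \<tau> j" for x y
      using that \<sigma> radial_near[OF dom] nb_sym unfolding \<tau>_def clique_near by blast
    then show "finite (\<tau> j) \<and> clique E (\<tau> j)"
      using \<sigma> unfolding clique_near \<tau>_def by auto
    then have cl: "clique E (radial u j ` \<sigma> \<union> radial u (Suc j) ` \<sigma>)" unfolding \<tau>_def by blast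
    fix z assume "z \<in> K j"
    then obtain t f where z: "z = (t, f)" "clock_phase N j t" "0 \<le> t" "f \<in> closed_simplex E \<sigma>"
      unfolding K_def by auto
    have "radial_homotopy u z = (\<lambda>v. \<Sum>a\<in>\<sigma>. f a *
        ((1 - clock t j) * of_bool (v = radial u j a) + clock t j * of_bool (v = radial u (Suc j) a)))"
      using z \<sigma> N radial_path_edge[OF z(2,3)] \<open>j \<in> {..N}\<close>
      by (intro ext) (simp add: radial_homotopy_simplex)
    also have "\<dots> \<in> closed_simplex E (\<tau> j)"
      unfolding \<tau>_def
      by (rule segments_in_closed_simplex)
        (use \<sigma> cl closed_simplexD[OF z(4)] clock_bounds in auto)
    finally show "radial_homotopy u z \<in> closed_simplex E (\<tau> j)" .
  next
    fix z assume "z \<in> topspace (top_of_set ?S)"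
    then show "\<exists>j\<in>{..N}. z \<in> K j"
      using clock_phase_exists[of "fst z" N] unfolding K_def by auto
  next
    fix v
    have coord: "continuous_on ?S (\<lambda>z. snd z a)" for a :: 'a
      by (rule continuous_on_compose2[OF continuous_on_product_coordinates]) (auto intro: continuous_intros)
    have "continuous_on ?S (\<lambda>z. \<Sum>a\<in>\<sigma>. snd z a * radial_path u a (fst z) v)"
      unfolding radial_path_def tele_def clock_def by (intro continuous_intros coord)
    then have "continuous_on ?S (\<lambda>z. radial_homotopy u z v)"
      by (rule continuous_on_eq) (use radial_homotopy_simplex \<sigma> in auto)
    then show "continuous_map (top_of_set ?S) euclideanreal (\<lambda>z. radial_homotopy u z v)"
      by simp
  qed simp
  then show "continuous_map (prod_topology (top_of_set {0..1}) (top_of_set (closed_simplex E \<sigma>)))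
      (clique_complex_topology E) (radial_homotopy u)"
    by simp
qed

lemma contractible_if_dominated:
  assumes dom: "BFS_dominated E u"
  shows "contractible_space (clique_complex_topology E)"
proof -
  let ?T = "clique_complex_topology E"
  have "homotopic_with (\<lambda>x. True) ?T ?T id (\<lambda>f v. of_bool (v = u))"
  proof (subst homotopic_with, simp, intro exI conjI ballI)
    show "continuous_map (prod_topology (top_of_set {0..1}) ?T) ?T (radial_homotopy u)"
      by (rule continuous_radial_homotopy[OF dom])
    fix f assume "f \<in> topspace ?T"
    then have f: "f \<in> closed_simplex E {a. f a \<noteq> 0}" "finite {a. f a \<noteq> 0}"
      unfolding closed_simplex_def by (auto simp: realization_def)
    have "radial_path u a 0 v = of_bool (v = a)" for a v
      unfolding radial_path_def
      by (subst tele_ones) (simp_all add: clock_def radial_id)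
    then have "radial_homotopy u (0, f) v = (\<Sum>a | f a \<noteq> 0. if v = a then f a else 0)" for v
      unfolding radial_homotopy_def by (intro sum.cong) auto
    then show "radial_homotopy u (0, f) = id f"
      using f(2) by (intro ext) simp
    \<comment> \<open>Time 1 is the end of phase 0, when each vertex has reached
      \<open>radial u 0 a\<close>; its distance from \<open>u\<close> is 0.\<close>
    have "clock_phase (d u a) 0 1" "clock 1 0 = 0" for a
      by (simp_all add: clock_phase_def clock_def)
    then have "radial_path u a 1 v = of_bool (v = u)" for a v
      using radial_path_edge[of "d u a" 0 1 u a v] gdist_radial[OF dom, of 0 a] by simp
    then show "radial_homotopy u (1, f) = (\<lambda>v. of_bool (v = u))"
      using closed_simplexD(3)[OF f]
      by (intro ext) (simp add: radial_homotopy_def sum_distrib_right[symmetric])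
  qed auto
  then show ?thesis unfolding contractible_space_def by blast
qed

section \<open>From topological to combinatorial simple connectivity\<close>

text \<open>Stuttering lets a walk with \<open>n\<close> edges be compared with the rows of a grid
  of width \<open>n * m\<close>.\<close>

lemma htp_slow:
  assumes "0 < m"
  shows "htp (map (\<lambda>i. x (i div m)) [0..<Suc (n * m)]) (map x [0..<Suc n])"
proof (induction n)
  case (Suc n)
  obtain m' where m: "m = Suc m'" using assms gr0_implies_Suc by blast
  have upt: "[0..<Suc (Suc n * m)] = [0..<Suc (n * m)] @ [Suc (n * m)..<n * m + m] @ [n * m + m]"
    using upt_add_eq_append[of 0 "Suc (n * m)" m'] m
    by (simp add: algebra_simps)
  have "map (\<lambda>i. x (i div m)) [Suc (n * m)..<n * m + m] = replicate m' (x n)"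
  proof (rule nth_equalityI)
    fix i assume "i < length (map (\<lambda>i. x (i div m)) [Suc (n * m)..<n * m + m])"
    then have i: "Suc i < m" by simp
    have "Suc (n * m) + i = n * m + Suc i" by simp
    then have "(Suc (n * m) + i) div m = n" using i by (metis div_less div_mult_self3 add_0 add.commute m nat.distinct(1) plus_nat.add_0)
    moreover have "[Suc (n * m)..<n * m + m] ! i = Suc (n * m) + i" using i by (intro nth_upt) simp
    moreover have "i < m'" using i m by simp
    ultimately show "map (\<lambda>i. x (i div m)) [Suc (n * m)..<n * m + m] ! i = replicate m' (x n) ! i"
      using i by simp
  qed (simp add: m del: upt_Suc)
  moreover have "(n * m + m) div m = Suc n" using assms by simp
  ultimately have "map (\<lambda>i. x (i div m)) [0..<Suc (Suc n * m)] =
      map (\<lambda>i. x (i div m)) [0..<Suc (n * m)] @ replicate m' (x n) @ [x (Suc n)]"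
    unfolding upt by simp
  also have "htp \<dots> (map x [0..<Suc n] @ replicate m' (x n) @ [x (Suc n)])"
    by (rule htp_append_right[OF Suc.IH])
  also have "map x [0..<Suc n] @ replicate m' (x n) @ [x (Suc n)] =
      map x [0..<n] @ replicate (Suc m') (x n) @ [x (Suc n)]" by simp
  also have "htp \<dots> (map x [0..<n] @ [x n] @ [x (Suc n)])"
    by (rule htp_append[OF htp_replicate])
  finally show ?case by simp
qed simp

lemma realization_nb: "\<lbrakk>f \<in> realization E; 0 < f v; 0 < f w\<rbrakk> \<Longrightarrow> nb v w"
  unfolding realization_def clique_near by fastforce

text \<open>A subdivision of the square is mapped to vertices whose open stars contain the images of the
  surrounding small squares; rows of the grid are then homotopic through triangles.\<close>
lemma simply_conn_if_simply_connected_space: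
  assumes "simply_connected_space (clique_complex_topology E)"
  shows simply_conn
  unfolding simply_conn_def
proof (intro allI impI)
  fix xs :: "'a list"
  assume xs: "xs \<noteq> [] \<and> walk xs \<and> last xs = hd xs"
  let ?T = "clique_complex_topology E"
  let ?I = "top_of_set {0..1::real}"
  define n where "n = length xs - 1"
  define x where "x = (!) xs"
  have len: "length xs = Suc n" using xs by (simp add: n_def)
  have map_x: "map x [0..<Suc n] = xs" unfolding x_def len[symmetric] by (rule map_nth)
  have x0: "hd xs = x 0" and xn: "x n = x 0"
    using xs len last_conv_nth[of xs] hd_conv_nth[of xs] by (simp_all add: x_def)
  have step: "nb (x i) (x (Suc i))" if "i < n" for i
    using xs that len by (simp add: successively_conv_nth x_def)
  show "htp xs [hd xs]"
  proof (cases "n = 0")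
    case True
    then show ?thesis using map_x x0 by simp
  next
    case False
    \<comment> \<open>With these coefficients \<open>tele\<close> runs along the edge from
      \<open>x j\<close> to \<open>x (Suc j)\<close> while \<open>real n * s\<close> grows from
      \<open>j\<close> to \<open>j + 1\<close>, which realises the walk as a loop.\<close>
    define c where "c s i = min 1 (max 0 (real n * s - real i))" for s :: real and i :: nat
    define p where "p s = tele x n (c s)" for s
    have p_edge: "p s v = (1 - c s j) * of_bool (v = x j) + c s j * of_bool (v = x (Suc j))"
      if "j < n" "real j \<le> real n * s" "real n * s \<le> real j + 1" for s j v
      unfolding p_def by (rule tele_edge) (use that in \<open>auto simp: c_def\<close>)
    have p_end: "p 1 v = of_bool (v = x n)" for v
      unfolding p_def by (rule tele_ones) (simp add: c_def)
    have p_start: "p 0 v = of_bool (v = x 0)" for v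
      using p_edge[of 0 0 v] False by (simp add: c_def)
    have edge_in: "(\<lambda>v. (1 - s) * of_bool (v = a) + s * of_bool (v = b)) \<in> closed_simplex E {a, b}"
      if "0 \<le> s" "s \<le> 1" "nb a b" for a b :: 'a and s :: real
      using segments_in_closed_simplex[of "{a}" "\<lambda>_. 1" s E "\<lambda>_. a" "\<lambda>_. b"] that nb_sym
      by (simp add: clique_near insert_commute)
    have "continuous_map ?I ?T p"
    proof (rule continuous_map_into_clique_complex[where J = "{..<n}" and \<sigma> = "\<lambda>j. {x j, x (Suc j)}"
          and K = "\<lambda>j. {0..1} \<inter> {s. real j \<le> real n * s \<and> real n * s \<le> real j + 1}"])
      fix j assume j: "j \<in> {..<n}"
      show "closedin ?I ({0..1} \<inter> {s. real j \<le> real n * s \<and> real n * s \<le> real j + 1})"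
        by (intro closedin_closed_Int closed_Collect_conj closed_Collect_le continuous_intros)
      show "finite {x j, x (Suc j)} \<and> clique E {x j, x (Suc j)}"
        using step j nb_sym by (simp add: clique_near)
      fix s assume s: "s \<in> {0..1} \<inter> {s. real j \<le> real n * s \<and> real n * s \<le> real j + 1}"
      have "p s = (\<lambda>v. (1 - c s j) * of_bool (v = x j) + c s j * of_bool (v = x (Suc j)))"
        using p_edge s j by auto
      then show "p s \<in> closed_simplex E {x j, x (Suc j)}"
        using edge_in[of "c s j"] step j by (simp add: c_def)
    next
      fix s assume "s \<in> topspace ?I"
      then have s: "0 \<le> s" "s \<le> 1" by auto
      define j where "j = min (n - 1) (nat \<lfloor>real n * s\<rfloor>)"
      have ns: "0 \<le> real n * s" "real n * s \<le> real n" using s by (auto simp: mult_left_le)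
      have "real j \<le> real n * s" unfolding j_def using ns(1) by linarith
      moreover have "real n * s \<le> real j + 1"
      proof (cases "n - 1 \<le> nat \<lfloor>real n * s\<rfloor>")
        case True
        then show ?thesis using ns False unfolding j_def by simp
      next
        case False
        then show ?thesis using ns(1) unfolding j_def by simp
      qed
      moreover have "j < n" using False unfolding j_def by simp
      ultimately show "\<exists>j\<in>{..<n}. s \<in> {0..1} \<inter> {s. real j \<le> real n * s \<and> real n * s \<le> real j + 1}"
        using s by auto
    next
      fix v
      show "continuous_map ?I euclideanreal (\<lambda>s. p s v)"
        unfolding continuous_map_iff_continuous p_def tele_def c_def by (intro continuous_intros)
    qed simp
    then have "pathin ?T p" by (simp add: pathin_def)
    moreover have "pathin ?T (\<lambda>_ v. of_bool (v = x 0))"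
      using edge_in[of 0 "x 0" "x 0"] by (simp add: pathin_def closed_simplex_def)
    moreover have "p 1 = p 0" using p_start p_end xn by auto
    ultimately have "homotopic_with (\<lambda>r. r 1 = r 0) ?I ?T p (\<lambda>_ v. of_bool (v = x 0))"
      using assms unfolding simply_connected_space_def by blast
    then obtain h where h: "continuous_map (prod_topology ?I ?I) ?T h"
      "\<And>s. h (0, s) = p s" "\<And>s. h (1, s) = (\<lambda>v. of_bool (v = x 0))"
      "\<And>t. t \<in> {0..1} \<Longrightarrow> h (t, 1) = h (t, 0)"
      unfolding homotopic_with_def by auto
    let ?S = "{0..1::real} \<times> {0..1::real}"
    have hS: "h z \<in> realization E" if "z \<in> ?S" for z
      using h(1) that unfolding continuous_map by auto
    have "\<exists>W. open W \<and> {z \<in> ?S. 0 < h z v} = ?S \<inter> W" for v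
    proof -
      have "openin (prod_topology ?I ?I) {z \<in> topspace (prod_topology ?I ?I). h z \<in> {f \<in> realization E. 0 < f v}}"
        by (rule openin_continuous_map_preimage[OF h(1) openin_star])
      moreover have "{z \<in> topspace (prod_topology ?I ?I). h z \<in> {f \<in> realization E. 0 < f v}} = {z \<in> ?S. 0 < h z v}"
        using hS by auto
      ultimately have "openin (top_of_set ?S) {z \<in> ?S. 0 < h z v}" by simp
      then show ?thesis unfolding openin_open by blast
    qed
    then obtain W where W: "\<And>v. open (W v)" "\<And>v. {z \<in> ?S. 0 < h z v} = ?S \<inter> W v" by metis
    have star: "\<exists>v. 0 < h z v" if z: "z \<in> ?S" for z
    proof (rule ccontr)
      assume "\<nexists>v. 0 < h z v"
      then have "{v. h z v \<noteq> 0} = {}" using hS[OF z] unfolding realization_def by (auto simp: less_le)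
      then show False using hS[OF z] unfolding realization_def by simp
    qed
    have "z \<in> \<Union>(range W)" if z: "z \<in> ?S" for z
    proof -
      obtain v where "0 < h z v" using star[OF z] by blast
      then have "z \<in> ?S \<inter> W v" unfolding W(2)[symmetric] using z by simp
      then show ?thesis by blast
    qed
    then have cov: "?S \<subseteq> \<Union>(range W)" by (rule subsetI)
    have opn: "open G" if "G \<in> range W" for G using W(1) that by auto
    have cpt: "compact ?S" by (intro compact_Times compact_Icc)
    \<comment> \<open>A Lebesgue number for the open stars pulled back along \<open>h\<close>. The
      mesh \<open>1 / real N\<close> is chosen so that two widths stay below it, which covers a grid
      point and its eight neighbours.\<close>
    obtain e where e: "0 < e" "\<And>z. z \<in> ?S \<Longrightarrow> \<exists>G\<in>range W. ball z e \<subseteq> G"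
      by (rule Heine_Borel_lemma[OF cpt cov]) (assumption | rule opn that)+
    obtain m :: nat where em: "2 / e < real m" using reals_Archimedean2 by blast
    moreover have "0 < 2 / e" using e(1) by simp
    ultimately have m: "0 < m" using of_nat_0_less_iff less_trans by blast
    define N where "N = n * m"
    have "0 < N" using m False by (simp add: N_def)
    have "m \<le> N" using False by (cases n) (simp_all add: N_def)
    then have "real m \<le> real N" by simp
    then have "e * real m \<le> e * real N" using e(1) by simp
    moreover have "2 < e * real m" using em e(1) by (simp add: pos_divide_less_eq mult.commute)
    ultimately have eN: "2 / real N < e" using \<open>0 < N\<close> by (simp add: pos_divide_less_eq)
    define g where "g j i = (real j / real N, real i / real N)" for j i :: nat
    have gS: "g j i \<in> ?S" if "j \<le> N" "i \<le> N" for j i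
      using that \<open>0 < N\<close> by (simp add: g_def)
    have "\<exists>v. \<forall>j'\<le>N. \<forall>i'\<le>N. j' \<le> Suc j \<and> j \<le> Suc j' \<and> i' \<le> Suc i \<and> i \<le> Suc i' \<longrightarrow> 0 < h (g j' i') v"
      if centre: "j \<le> N" "i \<le> N" for j i
    proof -
      obtain v where v: "ball (g j i) e \<subseteq> W v" using e(2)[OF gS[OF centre]] by blast
      have "0 < h (g j' i') v"
        if ji: "j' \<le> N" "i' \<le> N" "j' \<le> Suc j \<and> j \<le> Suc j' \<and> i' \<le> Suc i \<and> i \<le> Suc i'" for j' i'
      proof -
        have near: "\<bar>real a / real N - real b / real N\<bar> \<le> 1 / real N" if "b \<le> Suc a" "a \<le> Suc b" for a b :: nat
          using that \<open>0 < N\<close> by (simp add: diff_divide_distrib[symmetric] abs_le_iff divide_right_mono)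
        have "dist (g j i) (g j' i') \<le> \<bar>real j / real N - real j' / real N\<bar> + \<bar>real i / real N - real i' / real N\<bar>"
          unfolding g_def dist_Pair_Pair dist_real_def power2_abs by (rule sqrt_sum_squares_le_sum_abs)
        also have "\<dots> \<le> 1 / real N + 1 / real N" using near ji(3) by (intro add_mono) auto
        also have "\<dots> < e" using eN by simp
        finally have "g j' i' \<in> W v" using v by auto
        then show ?thesis using W(2)[of v] gS[OF ji(1,2)] by auto
      qed
      then show ?thesis by blast
    qed
    then obtain w where w: "\<And>j i j' i'. \<lbrakk>j \<le> N; i \<le> N; j' \<le> N; i' \<le> N; j' \<le> Suc j; j \<le> Suc j';
        i' \<le> Suc i; i \<le> Suc i'\<rbrakk> \<Longrightarrow> 0 < h (g j' i') (w j i)"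
      by metis
    \<comment> \<open>The last column takes the labels of the first, so that every row is a closed
      walk. This is consistent because \<open>h\<close> agrees on the two sides of the
      square.\<close>
    define b where "b j i = w j (if i = N then 0 else i)" for j i
    have loop: "h (g j N) = h (g j 0)" if "j \<le> N" for j
      using h(4)[of "real j / real N"] that \<open>0 < N\<close> by (simp add: g_def)
    have b0: "0 < h (g j' i) (b j i)" if "j \<le> N" "i \<le> N" "j' \<le> N" "j' \<le> Suc j" "j \<le> Suc j'" for j j' i
      using w[of j i j' i] w[of j 0 j' 0] loop[of j'] that by (auto simp: b_def)
    have b1: "0 < h (g j' (Suc i)) (b j i)" if "j \<le> N" "i < N" "j' \<le> N" "j' \<le> Suc j" "j \<le> Suc j'" for j j' i
      using w[of j i j' "Suc i"] that by (auto simp: b_def)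
    have nbI: "nb v v'" if "0 < h (g j i) v" "0 < h (g j i) v'" "j \<le> N" "i \<le> N" for v v' j i
      using realization_nb[OF hS[OF gS]] that by blast
    have bloop: "b j N = b j 0" for j by (simp add: b_def)
    \<comment> \<open>The induction descends from row \<open>N\<close>, where \<open>h\<close> is
      constant and every label is \<open>x 0\<close>, to row 0.\<close>
    have null: "htp (map (b j) [0..<Suc N]) [b j 0]" if "j \<le> N" for j
      using that
    proof (induction j rule: inc_induct)
      case base
      have "b N i = x 0" if "i \<le> N" for i
        using b0[of N i N] that h(3)[of "real i / real N"] \<open>0 < N\<close> by (auto simp: g_def split: if_splits)
      then have "map (b N) [0..<Suc N] = map (\<lambda>_. x 0) [0..<Suc N]" "b N 0 = x 0"
        by (auto simp del: upt_Suc)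
      then show ?case using htp_replicate[of N "x 0"] by (simp add: map_replicate_const del: upt_Suc)
    next
      case (step j)
      show ?case
      proof (rule htp_null_parallel[of N "b j" "b (Suc j)"])
        fix i assume "i < N"
        then show "nb (b j i) (b j (Suc i))" "nb (b (Suc j) i) (b (Suc j) (Suc i))"
          "nb (b (Suc j) i) (b j (Suc i))"
          using step nbI[OF b1[of j i j] b0[of j "Suc i" j]]
            nbI[OF b1[of "Suc j" i j] b0[of "Suc j" "Suc i" j]] nbI[OF b1[of "Suc j" i j] b0[of j "Suc i" j]]
          by simp_all
      next
        fix i assume "i \<le> N"
        then show "nb (b j i) (b (Suc j) i)"
          using step nbI[OF b0[of j i j] b0[of "Suc j" i j]] by simp
      qed (use bloop step in auto)
    qed
    \<comment> \<open>The slowed walk gives a second labelling of row 0, again by vertices of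
      positive weight: \<open>m\<close> grid steps traverse one edge. It is therefore parallel to
      \<open>b 0\<close>.\<close>
    define y where "y i = x (i div m)" for i
    have y_pos: "0 < h (g 0 i) (y i)" if "i \<le> N" for i
    proof (cases "i = N")
      case True
      then show ?thesis using p_end m \<open>0 < N\<close> by (simp add: g_def h(2) y_def N_def)
    next
      case False
      let ?j = "i div m"
      have "?j < n" using False that by (simp add: less_mult_imp_div_less N_def)
      have "real n * (real i / real N) = real i / real m"
        using \<open>0 < N\<close> by (simp add: N_def)
      moreover have "real i = real m * real ?j + real (i mod m)"
        by (metis mult_div_mod_eq of_nat_add of_nat_mult)
      then have "real ?j \<le> real i / real m" "real i / real m < real ?j + 1"
        using m by (simp_all add: field_simps)
      ultimately show ?thesis
        using p_edge[of ?j "real i / real N" "y i"] \<open>?j < n\<close> by (auto simp: g_def h(2) y_def c_def)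
    qed
    have "htp (map y [0..<Suc N]) [y 0]"
    proof (rule htp_null_parallel[of N y "b 0"])
      fix i assume i: "i < N"
      show "nb (b 0 i) (b 0 (Suc i))" using nbI[OF b1[of 0 i 0] b0[of 0 "Suc i" 0]] i by simp
      show "nb (b 0 i) (y (Suc i))" using nbI[OF b1[of 0 i 0] y_pos[of "Suc i"]] i by simp
      have "i div m < n" using i by (simp add: less_mult_imp_div_less N_def)
      then show "nb (y i) (y (Suc i))" using step by (auto simp: y_def div_Suc)
    next
      fix i assume "i \<le> N"
      then show "nb (y i) (b 0 i)" using nbI[OF y_pos[of i] b0[of 0 i 0]] by simp
    qed (use null[of 0] xn m in \<open>auto simp: y_def N_def\<close>)
    moreover have "htp (map y [0..<Suc N]) xs"
      using htp_slow[OF m, of x n] map_x unfolding y_def N_def by simp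
    ultimately show ?thesis
      using x0 by (auto simp: y_def intro: htp_trans htp_sym)
  qed
qed

end

theorem theorem3p8:
  fixes E :: "'a \<Rightarrow> 'a \<Rightarrow> bool"
  assumes "\<And>x y. E x y \<Longrightarrow> E y x"
    and "\<And>x. \<not> E x x"
    and "gconnected E"
  shows "(Helly E \<longleftrightarrow> one_Helly E \<and> weakly_modular E)
       \<and> (Helly E \<longleftrightarrow> clique_Helly E \<and> dismantlable E)
       \<and> (Helly E \<longleftrightarrow> clique_Helly E \<and> simply_connected_space (clique_complex_topology E))
       \<and> (finite_dimensional_cc E \<longrightarrow>
            (Helly E \<longleftrightarrow> clique_Helly E \<and> contractible_space (clique_complex_topology E)))"
proof -
  interpret connected_graph E by unfold_locales (use assms in auto)
  have from_Helly: "clique_Helly E" "one_Helly E" "weakly_modular E" "dismantlable E"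
    "contractible_space (clique_complex_topology E)" if "Helly E"
  proof -
    have dom: "BFS_dominated E u" for u by (rule BFS_dominated_if_Helly[OF that])
    show "one_Helly E" by (rule one_Helly_if_Helly[OF that])
    then show "clique_Helly E" by (rule clique_Helly_if_one_Helly)
    show "weakly_modular E" by (rule weakly_modular_if_dominated[OF dom])
    show "dismantlable E" by (rule dismantlable_if_dominated[OF dom])
    show "contractible_space (clique_complex_topology E)" by (rule contractible_if_dominated[OF dom])
  qed
  have to_Helly: "Helly E" if "clique_Helly E" simply_conn
    using Helly_if_dominated BFS_dominated_if_simply_conn that by blast
  \<comment> \<open>Each of (ii) to (v) yields \<open>simply_conn\<close> together with the
    clique-Helly property, and so leads back to (i) by \<open>to_Helly\<close>.\<close>
  note contractible_imp_simply_connected_space simply_conn_if_simply_connected_space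
    simply_conn_if_dismantlable simply_conn_if_weakly_modular clique_Helly_if_one_Helly
  with from_Helly to_Helly show ?thesis by blast
qed

unused_thms

end
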